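(* Let $V$ be the $\mathcal O_q$-module, $L$ the Lusztig automorphism of $\mathcal O_q$, and $H\in\mathrm{End}(V)$ the invertible map described in the context. The following are isomorphic tridiagonal pairs: (i) the action of $A,A^*$ on $V$; (ii) the action of $A,L(A^* )$ on $V$; (iii) the action of $A,L^{-1}(A^* )$ on $V$. Moreover, the map $H$ is an isomorphism of tridiagonal pairs from (ii) to (i) and from (i) to (iii).
   Context: Setting. $\mathbb F$ is a field and $q\in\mathbb F$ is nonzero and not a root of unity. Algebras are associative, unital, over $\mathbb F$. Write $[X,Y]=XY-YX$, $[X,Y]_q=qXY-q^{-1}YX$, $[X,Y]_{q^{-1}}=q^{-1}XY-qYX$. The $q$-Onsager algebra $\mathcal O_q$ is defined by generators $A,A^*$ and relations $[A,[A,[A,A^*]_q]_{q^{-1}}]=(q^2-q^{-2})^2[A^*,A]$ and $[A^*,[A^*,[A^*,A]_q]_{q^{-1}}]=(q^2-q^{-2})^2[A,A^*]$. $V$ is an irreducible $\mathcal O_q$-module of finite dimension at least $2$ on which each of $A,A^*$ is diagonalizable. Eigenspaces. The eigenvalues of $A$ on $V$ can be ordered as mutually distinct $\theta_0,\dots,\theta_d$ ($d\ge 1$) such that $\theta_i=aq^{d-2i}+a^{-1}q^{2i-d}$ ($0\le i\le d$) for some nonzero $a\in\mathbb F$; fix such an ordering and $a$. $V_i$ is the $\theta_i$-eigenspace of $A$ and $E_i\in\mathrm{End}(V)$ is the projection onto $V_i$ along $\bigoplus_{j\ne i}V_j$; one has $A^*V_i\subseteq V_{i-1}+V_i+V_{i+1}$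 ($V_{-1}=V_{d+1}=0$). Lusztig automorphism. $L$ is the automorphism of $\mathcal O_q$ with $L(A)=A$, $L(A^* )=A^*+\frac{[A,[A,A^*]_q]}{(q-q^{-1})(q^2-q^{-2})}$; its inverse satisfies $L^{-1}(A)=A$, $L^{-1}(A^* )=A^*+\frac{[A,[A,A^*]_{q^{-1}}]}{(q-q^{-1})(q^2-q^{-2})}$. The map $H$. Let $t_{ij}=1+\frac{\theta_i-\theta_j}{q-q^{-1}}\cdot\frac{q\theta_i-q^{-1}\theta_j}{q^2-q^{-2}}$, $t_i=t_{01}t_{12}\cdots t_{i-1,i}$ ($t_0=1$), and $H=\sum_{i=0}^d t_iE_i\in\mathrm{End}(V)$; each $t_i\neq0$, so $H$ is invertible. Tridiagonal pairs. For a nonzero finite-dimensional vector space $W$, a tridiagonal pair on $W$ is an ordered pair $T,T^*$ of $\mathbb F$-linear maps $W\to W$ such that: (a) each of $T,T^*$ is diagonalizable; (b) there is an ordering $\{W_i\}_{i=0}^{d}$ of the eigenspaces of $T$ with $T^*W_i\subseteq W_{i-1}+W_i+W_{i+1}$ for all $i$ ($W_{-1}=W_{d+1}=0$); (c) there is an ordering $\{W^*_i\}_{i=0}^{\delta}$ of the eigenspaces of $T^*$ with $TW^*_i\subseteq W^*_{i-1}+W^*_i+W^*_{i+1}$ for all $i$ ($W^*_{-1}=W^*_{\delta+1}=0$); (d) no subspace $U$ with $0\ne U\ne W$ satisfies $TU\subseteq U$ and $T^*U\subseteq U$. An isomorphism of tridiagonal pairs from $T,T^*$ on $W$ to $S,S^*$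 on $W'$ is an $\mathbb F$-linear bijection $\gamma:W\to W'$ with $\gamma T=S\gamma$ and $\gamma T^*=S^*\gamma$. *)

theory Defs
  imports Complex_Main "HOL-Algebra.QuotRing" "HOL-Algebra.Module" "HOL-Library.Poly_Mapping"
begin

section \<open>Algebras over a field\<close>

text \<open>
  An associative unital algebra over the field given by the type \<open>'a\<close> is represented by a
  HOL-Algebra record \<open>('a, 'r) module\<close>; all its operations are the record's own. (The locale
  \<open>algebra\<close> of HOL-Algebra requires commutativity, so it is not used.)
\<close>

definition alg_hom :: "('a, 'r) module \<Rightarrow> ('a, 's) module \<Rightarrow> ('r \<Rightarrow> 's) set" where
  "alg_hom R S = {h \<in> ring_hom R S.
     \<forall>c. \<forall>x \<in> carrier R. h (c \<odot>\<^bsub>R\<^esub> x) = c \<odot>\<^bsub>S\<^esub> h x}"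

definition alg_automorphism :: "('a, 'r) module \<Rightarrow> ('r \<Rightarrow> 'r) \<Rightarrow> bool" where
  "alg_automorphism R h \<longleftrightarrow> h \<in> alg_hom R R \<and> bij_betw h (carrier R) (carrier R)"

definition comm :: "('a, 'r) module \<Rightarrow> 'r \<Rightarrow> 'r \<Rightarrow> 'r" where
  "comm R X Y = X \<otimes>\<^bsub>R\<^esub> Y \<ominus>\<^bsub>R\<^esub> Y \<otimes>\<^bsub>R\<^esub> X"

text \<open>\<open>qcomm R q X Y\<close> is \<open>[X,Y]\<^sub>q\<close>; the bracket with subscript \<open>q\<close> inverse is
  \<open>qcomm R (inverse q) X Y\<close>.\<close>

definition qcomm :: "('a::field, 'r) module \<Rightarrow> 'a \<Rightarrow> 'r \<Rightarrow> 'r \<Rightarrow> 'r" where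
  "qcomm R q X Y =
     q \<odot>\<^bsub>R\<^esub> (X \<otimes>\<^bsub>R\<^esub> Y) \<ominus>\<^bsub>R\<^esub> inverse q \<odot>\<^bsub>R\<^esub> (Y \<otimes>\<^bsub>R\<^esub> X)"

section \<open>The free algebra on two generators\<close>

datatype gen = GenA | GenAs

datatype gen_word = Word "gen list"

text \<open>Words under concatenation, written additively because the convolution product of
  \<open>Poly_Mapping\<close> is indexed by additive monoids.\<close>

instantiation gen_word :: monoid_add
begin

definition zero_gen_word :: gen_word where
  "zero_gen_word = Word []"

fun plus_gen_word :: "gen_word \<Rightarrow> gen_word \<Rightarrow> gen_word" where
  "plus_gen_word (Word u) (Word v) = Word (u @ v)"

instance
proof
  fix x y z :: gen_word
  show "x + y + z = x + (y + z)"
    by (cases x; cases y; cases z) simp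
  show "0 + x = x" "x + 0 = x"
    by (cases x; simp add: zero_gen_word_def)+
qed

end

definition free_alg :: "('a::field, gen_word \<Rightarrow>\<^sub>0 'a) module" where
  "free_alg = \<lparr>carrier = UNIV, mult = (*), one = 1, zero = 0, add = (+),
     smult = (\<lambda>c x. Poly_Mapping.single 0 c * x)\<rparr>"

definition free_gen :: "gen \<Rightarrow> gen_word \<Rightarrow>\<^sub>0 'a::field" where
  "free_gen g = Poly_Mapping.single (Word [g]) 1"

lemma ring_free_alg: "ring (free_alg :: ('a::field, gen_word \<Rightarrow>\<^sub>0 'a) module)"
proof (rule ringI)
  show "abelian_group (free_alg :: ('a, gen_word \<Rightarrow>\<^sub>0 'a) module)"
  proof (rule abelian_groupI)
    fix x :: "gen_word \<Rightarrow>\<^sub>0 'a"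
    show "\<exists>y \<in> carrier free_alg. y \<oplus>\<^bsub>free_alg\<^esub> x = \<zero>\<^bsub>free_alg\<^esub>"
      by (rule bexI[of _ "- x"]) (simp_all add: free_alg_def)
  qed (simp_all add: free_alg_def algebra_simps)
  show "Group.monoid (free_alg :: ('a, gen_word \<Rightarrow>\<^sub>0 'a) module)"
    by (rule Group.monoidI) (simp_all add: free_alg_def algebra_simps)
qed (simp_all add: free_alg_def algebra_simps)

section \<open>The q-Onsager algebra and its Lusztig automorphism\<close>

text \<open>Left-hand side minus right-hand side of the first defining relation; exchanging \<open>X\<close> and
  \<open>Y\<close> gives the second one.\<close>

definition onsager_relator :: "('a::field, 'r) module \<Rightarrow> 'a \<Rightarrow> 'r \<Rightarrow> 'r \<Rightarrow> 'r" where
  "onsager_relator R q X Y =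
     comm R X (qcomm R (inverse q) X (qcomm R q X Y))
       \<ominus>\<^bsub>R\<^esub> ((q\<^sup>2 - inverse (q\<^sup>2))\<^sup>2) \<odot>\<^bsub>R\<^esub> comm R Y X"

definition onsager_ideal :: "'a::field \<Rightarrow> (gen_word \<Rightarrow>\<^sub>0 'a) set" where
  "onsager_ideal q = genideal free_alg
     {onsager_relator free_alg q (free_gen GenA) (free_gen GenAs),
      onsager_relator free_alg q (free_gen GenAs) (free_gen GenA)}"

text \<open>The quotient ring together with the induced scalar multiplication, the latter in the same
  style as the product \<open>rcoset_mult\<close> of cosets.\<close>

definition q_onsager :: "'a::field \<Rightarrow> ('a, (gen_word \<Rightarrow>\<^sub>0 'a) set) module" where
  "q_onsager q = (let Q = free_alg Quot onsager_ideal q in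
     \<lparr>carrier = carrier Q, mult = mult Q, one = one Q, zero = zero Q, add = add Q,
      smult = (\<lambda>c X. \<Union>x \<in> X. onsager_ideal q +>\<^bsub>free_alg\<^esub> (c \<odot>\<^bsub>free_alg\<^esub> x))\<rparr>)"

definition onsA :: "'a::field \<Rightarrow> (gen_word \<Rightarrow>\<^sub>0 'a) set" where
  "onsA q = onsager_ideal q +>\<^bsub>free_alg\<^esub> free_gen GenA"

definition onsAs :: "'a::field \<Rightarrow> (gen_word \<Rightarrow>\<^sub>0 'a) set" where
  "onsAs q = onsager_ideal q +>\<^bsub>free_alg\<^esub> free_gen GenAs"

text \<open>The conditions determine \<open>L\<close> on the carrier, since \<open>A\<close> and \<open>A\<^sup>*\<close> generate the algebra.\<close>

definition lusztig_automorphism ::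
  "'a::field \<Rightarrow> ((gen_word \<Rightarrow>\<^sub>0 'a) set \<Rightarrow> (gen_word \<Rightarrow>\<^sub>0 'a) set) \<Rightarrow> bool" where
  "lusztig_automorphism q L \<longleftrightarrow>
     alg_automorphism (q_onsager q) L \<and>
     L (onsA q) = onsA q \<and>
     L (onsAs q) = onsAs q \<oplus>\<^bsub>q_onsager q\<^esub>
       inverse ((q - inverse q) * (q\<^sup>2 - inverse (q\<^sup>2))) \<odot>\<^bsub>q_onsager q\<^esub>
         comm (q_onsager q) (onsA q) (qcomm (q_onsager q) q (onsA q) (onsAs q))"

section \<open>Modules\<close>

definition End_alg :: "('a::field \<Rightarrow> 'v::ab_group_add \<Rightarrow> 'v) \<Rightarrow> ('a, 'v \<Rightarrow> 'v) module" where
  "End_alg scale = \<lparr>carrier = {f. Vector_Spaces.linear scale scale f},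
     mult = (\<circ>), one = id, zero = (\<lambda>v. 0), add = (\<lambda>f g v. f v + g v),
     smult = (\<lambda>c f v. scale c (f v))\<rparr>"

text \<open>A module is a vector space (the type \<open>'v\<close> with \<open>scale\<close>) with a representation \<open>\<rho>\<close>;
  the element \<open>x\<close> of the algebra acts as \<open>\<rho> x\<close>.\<close>

definition alg_module ::
  "('a::field, 'r) module \<Rightarrow> ('a \<Rightarrow> 'v::ab_group_add \<Rightarrow> 'v) \<Rightarrow> ('r \<Rightarrow> 'v \<Rightarrow> 'v) \<Rightarrow> bool" where
  "alg_module R scale \<rho> \<longleftrightarrow> vector_space scale \<and> \<rho> \<in> alg_hom R (End_alg scale)"

definition irreducible_alg_module ::
  "('a::field, 'r) module \<Rightarrow> ('a \<Rightarrow> 'v::ab_group_add \<Rightarrow> 'v) \<Rightarrow> ('r \<Rightarrow> 'v \<Rightarrow> 'v) \<Rightarrow> bool" where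
  "irreducible_alg_module R scale \<rho> \<longleftrightarrow>
     alg_module R scale \<rho> \<and>
     (UNIV :: 'v set) \<noteq> {0} \<and>
     (\<forall>U. module.subspace scale U \<and> (\<forall>x \<in> carrier R. \<rho> x ` U \<subseteq> U) \<longrightarrow> U = {0} \<or> U = UNIV)"

section \<open>Eigenspaces and tridiagonal pairs\<close>

definition finite_dim :: "('a::field \<Rightarrow> 'v::ab_group_add \<Rightarrow> 'v) \<Rightarrow> bool" where
  "finite_dim scale \<longleftrightarrow> (\<exists>B. finite_dimensional_vector_space scale B)"

definition eigenspace :: "('a::field \<Rightarrow> 'v::ab_group_add \<Rightarrow> 'v) \<Rightarrow> ('v \<Rightarrow> 'v) \<Rightarrow> 'a \<Rightarrow> 'v set" where
  "eigenspace scale T c = {v. T v = scale c v}"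

definition eigenvalues :: "('a::field \<Rightarrow> 'v::ab_group_add \<Rightarrow> 'v) \<Rightarrow> ('v \<Rightarrow> 'v) \<Rightarrow> 'a set" where
  "eigenvalues scale T = {c. \<exists>v. v \<noteq> 0 \<and> T v = scale c v}"

definition diagonalizable :: "('a::field \<Rightarrow> 'v::ab_group_add \<Rightarrow> 'v) \<Rightarrow> ('v \<Rightarrow> 'v) \<Rightarrow> bool" where
  "diagonalizable scale T \<longleftrightarrow>
     module.span scale (\<Union>c \<in> eigenvalues scale T. eigenspace scale T c) = UNIV"

text \<open>\<open>W 0, \<dots>, W d\<close> is an ordering of the eigenspaces of \<open>T\<close> on which \<open>S\<close> acts in a tridiagonal
  way. Indices are integers, so that the conventions for the indices \<open>-1\<close> and \<open>d + 1\<close> can be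
  stated literally.\<close>

definition tridiagonal_ordering ::
  "('a::field \<Rightarrow> 'v::ab_group_add \<Rightarrow> 'v) \<Rightarrow> ('v \<Rightarrow> 'v) \<Rightarrow> ('v \<Rightarrow> 'v) \<Rightarrow> nat \<Rightarrow> (int \<Rightarrow> 'v set) \<Rightarrow> bool" where
  "tridiagonal_ordering scale T S d W \<longleftrightarrow>
     bij_betw W {0..int d} (eigenspace scale T ` eigenvalues scale T) \<and>
     W (-1) = {0} \<and> W (int d + 1) = {0} \<and>
     (\<forall>i \<in> {0..int d}. S ` W i \<subseteq>
        {x + y + z | x y z. x \<in> W (i - 1) \<and> y \<in> W i \<and> z \<in> W (i + 1)})"

definition tridiagonal_pair ::
  "('a::field \<Rightarrow> 'v::ab_group_add \<Rightarrow> 'v) \<Rightarrow> ('v \<Rightarrow> 'v) \<Rightarrow> ('v \<Rightarrow> 'v) \<Rightarrow> bool" where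
  "tridiagonal_pair scale T Ts \<longleftrightarrow>
     finite_dim scale \<and> (UNIV :: 'v set) \<noteq> {0} \<and>
     Vector_Spaces.linear scale scale T \<and> Vector_Spaces.linear scale scale Ts \<and>
     diagonalizable scale T \<and> diagonalizable scale Ts \<and>
     (\<exists>d W. tridiagonal_ordering scale T Ts d W) \<and>
     (\<exists>\<delta> Ws. tridiagonal_ordering scale Ts T \<delta> Ws) \<and>
     \<not> (\<exists>U. module.subspace scale U \<and> U \<noteq> {0} \<and> U \<noteq> UNIV \<and> T ` U \<subseteq> U \<and> Ts ` U \<subseteq> U)"

definition td_isomorphism ::
  "('a::field \<Rightarrow> 'v::ab_group_add \<Rightarrow> 'v) \<Rightarrow> ('v \<Rightarrow> 'v) \<Rightarrow> ('v \<Rightarrow> 'v) \<Rightarrow>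
   ('a \<Rightarrow> 'w::ab_group_add \<Rightarrow> 'w) \<Rightarrow> ('w \<Rightarrow> 'w) \<Rightarrow> ('w \<Rightarrow> 'w) \<Rightarrow> ('v \<Rightarrow> 'w) \<Rightarrow> bool" where
  "td_isomorphism scale T Ts scale' S Ss \<gamma> \<longleftrightarrow>
     tridiagonal_pair scale T Ts \<and> tridiagonal_pair scale' S Ss \<and>
     Vector_Spaces.linear scale scale' \<gamma> \<and> bij \<gamma> \<and>
     \<gamma> \<circ> T = S \<circ> \<gamma> \<and> \<gamma> \<circ> Ts = Ss \<circ> \<gamma>"

definition td_isomorphic ::
  "('a::field \<Rightarrow> 'v::ab_group_add \<Rightarrow> 'v) \<Rightarrow> ('v \<Rightarrow> 'v) \<Rightarrow> ('v \<Rightarrow> 'v) \<Rightarrow>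
   ('a \<Rightarrow> 'w::ab_group_add \<Rightarrow> 'w) \<Rightarrow> ('w \<Rightarrow> 'w) \<Rightarrow> ('w \<Rightarrow> 'w) \<Rightarrow> bool" where
  "td_isomorphic scale T Ts scale' S Ss \<longleftrightarrow> (\<exists>\<gamma>. td_isomorphism scale T Ts scale' S Ss \<gamma>)"

section \<open>The map H\<close>

definition projection_along ::
  "('a::field \<Rightarrow> 'v::ab_group_add \<Rightarrow> 'v) \<Rightarrow> 'v set \<Rightarrow> 'v set \<Rightarrow> ('v \<Rightarrow> 'v) \<Rightarrow> bool" where
  "projection_along scale U W P \<longleftrightarrow>
     Vector_Spaces.linear scale scale P \<and> (\<forall>v \<in> U. P v = v) \<and> (\<forall>v \<in> W. P v = 0)"

definition t_pair :: "'a::field \<Rightarrow> (nat \<Rightarrow> 'a) \<Rightarrow> nat \<Rightarrow> nat \<Rightarrow> 'a" where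
  "t_pair q \<theta> i j =
     1 + (\<theta> i - \<theta> j) / (q - inverse q)
         * ((q * \<theta> i - inverse q * \<theta> j) / (q\<^sup>2 - inverse (q\<^sup>2)))"

definition t_coeff :: "'a::field \<Rightarrow> (nat \<Rightarrow> 'a) \<Rightarrow> nat \<Rightarrow> 'a" where
  "t_coeff q \<theta> i = (\<Prod>k<i. t_pair q \<theta> k (Suc k))"

definition H_map ::
  "('a::field \<Rightarrow> 'v::ab_group_add \<Rightarrow> 'v) \<Rightarrow> 'a \<Rightarrow> nat \<Rightarrow> (nat \<Rightarrow> 'a) \<Rightarrow> (nat \<Rightarrow> 'v \<Rightarrow> 'v) \<Rightarrow> 'v \<Rightarrow> 'v" where
  "H_map scale q d \<theta> E v = (\<Sum>i\<le>d. scale (t_coeff q \<theta> i) (E i v))"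

end

theory Submission
  imports Defs
begin

text \<open>
  The proof compares blocks. Let \<open>A\<close> act on the eigenspace \<open>V\<^sub>j\<close> as the scalar
  \<open>\<theta>\<^sub>j\<close>. Taking a bracket with \<open>A\<close> then multiplies the block of an operator that leads from
  \<open>V\<^sub>j\<close> to \<open>V\<^sub>i\<close> by a scalar (\<open>op_bracket_eigenvector\<close>), so statements about iterated brackets
  become statements about \<open>\<theta>\<^sub>i\<close> and \<open>\<theta>\<^sub>j\<close>.

  For the first defining relation this says that a nonzero block of \<open>A\<^sup>*\<close> from \<open>V\<^sub>j\<close> to \<open>V\<^sub>i\<close>
  needs \<open>i = j\<close> or a symmetric quadratic equation between \<open>\<theta>\<^sub>i\<close> and \<open>\<theta>\<^sub>j\<close>
  (\<open>dolan_grady_adjacent\<close>); for the given eigenvalues the equation forces \<open>|i - j| = 1\<close>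
  (\<open>q_adjacent_spectrum\<close>). For the definition of \<open>L\<close> it says that passing from \<open>A\<^sup>*\<close> to
  \<open>L(A\<^sup>*)\<close> multiplies the block by \<open>t\<^sub>i\<^sub>j\<close>, while passing to \<open>H\<inverse> A\<^sup>* H\<close> multiplies it by
  \<open>t\<^sub>j / t\<^sub>i\<close>. The two factors agree when \<open>|i - j| \<le> 1\<close>: for \<open>j = i + 1\<close> by definition of
  \<open>t\<^sub>j\<close>, and for \<open>i = j + 1\<close> because \<open>t\<^sub>i\<^sub>j\<close> and \<open>t\<^sub>j\<^sub>i\<close> are inverse to each other
  (\<open>t_pair_Suc\<close>). Hence \<open>H L(A\<^sup>*) = A\<^sup>* H\<close> (\<open>H_map_intertwines\<close>), and \<open>H\<close> commutes with
  \<open>A = L(A)\<close>.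

  The inverse of \<open>L\<close> is reached through module homomorphisms. The two equations say that
  \<open>H\<close> intertwines, on the generators, the module twisted by \<open>L\<close> with the module itself, hence does so for every element of
  the algebra (\<open>intertwiner_from_generators\<close>); the element \<open>L\<inverse>(A\<^sup>*)\<close> yields
  \<open>H A\<^sup>* = L\<inverse>(A\<^sup>*) H\<close>.

  It remains to see that (i) is a tridiagonal pair; the bijection \<open>H\<close> carries this over to (ii)
  and (iii). Here \<open>A\<close> and \<open>A\<^sup>*\<close> play the same role. Join two eigenvalues of one of
  them when they satisfy the quadratic equation. Every eigenvalue has at most two neighbours, since
  these are roots of a quadratic polynomial; the graph is connected, since the module is irreducible;
  and it is not a cycle, since \<open>q\<close> is not a root of unity. So it is a path (\<open>q_adjacent_path\<close>),
  and the order along the path is the required ordering of the eigenspaces.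
\<close>

section \<open>The q-Onsager algebra: cosets and induction\<close>

abbreviation onsager_class :: "'a::field \<Rightarrow> (gen_word \<Rightarrow>\<^sub>0 'a) \<Rightarrow> (gen_word \<Rightarrow>\<^sub>0 'a) set" where
  "onsager_class q p \<equiv> onsager_ideal q +>\<^bsub>free_alg\<^esub> p"

lemma ideal_onsager: "ideal (onsager_ideal q) free_alg"
  unfolding onsager_ideal_def
  by (rule ring.genideal_ideal[OF ring_free_alg]) (simp add: free_alg_def)

lemma free_alg_simps [simp]:
  "carrier free_alg = UNIV" "p \<otimes>\<^bsub>free_alg\<^esub> r = p * r" "\<one>\<^bsub>free_alg\<^esub> = 1" "\<zero>\<^bsub>free_alg\<^esub> = 0"
  "p \<oplus>\<^bsub>free_alg\<^esub> r = p + r" "c \<odot>\<^bsub>free_alg\<^esub> p = Poly_Mapping.single 0 c * p"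
  by (simp_all add: free_alg_def)

lemma free_alg_minus [simp]: "p \<ominus>\<^bsub>free_alg\<^esub> r = p - r"
proof -
  interpret ring free_alg by (rule ring_free_alg)
  have "\<ominus>\<^bsub>free_alg\<^esub> r = - r"
    by (rule minus_equality) simp_all
  then show ?thesis
    by (simp add: a_minus_def)
qed

lemma onsager_class_eqI:
  assumes "p - r \<in> onsager_ideal q"
  shows "onsager_class q p = onsager_class q r"
  using ring.quotient_eq_iff_same_a_r_cos[OF ring_free_alg ideal_onsager, of p r] assms by simp

lemma q_onsager_ops:
  "carrier (q_onsager q) = carrier (free_alg Quot onsager_ideal q)"
  "mult (q_onsager q) = mult (free_alg Quot onsager_ideal q)"
  "one (q_onsager q) = one (free_alg Quot onsager_ideal q)"
  "zero (q_onsager q) = zero (free_alg Quot onsager_ideal q)"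
  "add (q_onsager q) = add (free_alg Quot onsager_ideal q)"
  by (simp_all add: q_onsager_def Let_def)

lemma q_onsager_minus:
  "X \<ominus>\<^bsub>q_onsager q\<^esub> Y = X \<ominus>\<^bsub>free_alg Quot onsager_ideal q\<^esub> Y"
  by (simp add: a_minus_def a_inv_def m_inv_def q_onsager_ops)

lemma onsager_class_carrier: "onsager_class q p \<in> carrier (q_onsager q)"
  using ring_hom_closed[OF ideal.rcos_ring_hom[OF ideal_onsager], of p q]
  by (simp add: q_onsager_ops)

lemma onsager_class_surj:
  assumes "x \<in> carrier (q_onsager q)"
  obtains p where "x = onsager_class q p"
  using assms by (auto simp: q_onsager_ops FactRing_def A_RCOSETS_def')

lemma onsager_class_add:
  "onsager_class q (p + r) = onsager_class q p \<oplus>\<^bsub>q_onsager q\<^esub> onsager_class q r"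
  using ring_hom_add[OF ideal.rcos_ring_hom[OF ideal_onsager], of p r q]
  by (simp add: q_onsager_ops)

lemma onsager_class_mult:
  "onsager_class q (p * r) = onsager_class q p \<otimes>\<^bsub>q_onsager q\<^esub> onsager_class q r"
  using ring_hom_mult[OF ideal.rcos_ring_hom[OF ideal_onsager], of p r q]
  by (simp add: q_onsager_ops)

lemma onsager_class_one: "onsager_class q 1 = \<one>\<^bsub>q_onsager q\<^esub>"
  using ring_hom_one[OF ideal.rcos_ring_hom[OF ideal_onsager], of q]
  by (simp add: q_onsager_ops)

lemma onsager_class_minus:
  "onsager_class q (p - r) = onsager_class q p \<ominus>\<^bsub>q_onsager q\<^esub> onsager_class q r"
proof -
  interpret h: ring_hom_ring free_alg "free_alg Quot onsager_ideal q" "onsager_class q"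
    by (rule ideal.rcos_ring_hom_ring[OF ideal_onsager])
  have "onsager_class q (p \<ominus>\<^bsub>free_alg\<^esub> r)
      = onsager_class q p \<ominus>\<^bsub>free_alg Quot onsager_ideal q\<^esub> onsager_class q r"
    by (simp only: a_minus_def h.hom_add h.hom_a_inv free_alg_simps UNIV_I h.R.a_inv_closed)
       (use h.hom_add[of p "\<ominus>\<^bsub>free_alg\<^esub> r"] h.hom_a_inv[of r] in simp)
  then show ?thesis
    by (simp add: q_onsager_minus)
qed

text \<open>
  The scalar multiplication of the quotient is a union over representatives; all its members
  coincide because the ideal absorbs the scalars of \<open>free_alg\<close> from the left.
\<close>

lemma onsager_class_smult:
  "onsager_class q (Poly_Mapping.single 0 c * p) = c \<odot>\<^bsub>q_onsager q\<^esub> onsager_class q p"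
proof -
  interpret I: ideal "onsager_ideal q" free_alg
    by (rule ideal_onsager)
  have "onsager_class q (Poly_Mapping.single 0 c * x) = onsager_class q (Poly_Mapping.single 0 c * p)"
    if "x \<in> onsager_class q p" for x
  proof (rule onsager_class_eqI)
    have "x - p \<in> onsager_ideal q"
      using that I.a_rcos_module_imp[of p x] by (simp flip: a_minus_def)
    then show "Poly_Mapping.single 0 c * x - Poly_Mapping.single 0 c * p \<in> onsager_ideal q"
      using I.I_l_closed[of "x - p" "Poly_Mapping.single 0 c"]
      by (simp add: right_diff_distrib)
  qed
  moreover have "p \<in> onsager_class q p"
    by (rule I.a_rcos_self) simp
  ultimately have "(\<Union>x\<in>onsager_class q p. onsager_class q (Poly_Mapping.single 0 c * x))
      = onsager_class q (Poly_Mapping.single 0 c * p)"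
    by (intro SUP_eq_const) (rule notI, simp)
  then show ?thesis
    by (simp only: q_onsager_def Let_def module.simps free_alg_simps)
qed

lemma onsager_class_comm:
  "onsager_class q (comm free_alg p r) = comm (q_onsager q) (onsager_class q p) (onsager_class q r)"
  by (simp add: comm_def onsager_class_minus onsager_class_mult)

lemma onsager_class_qcomm:
  "onsager_class q (qcomm free_alg c p r) = qcomm (q_onsager q) c (onsager_class q p) (onsager_class q r)"
  unfolding qcomm_def free_alg_minus free_alg_simps onsager_class_minus onsager_class_smult
  by (simp add: onsager_class_mult)

text \<open>
  Every element is a linear combination of words, and every word is a product of generators.
\<close>

lemma free_alg_induct [case_names one gen add mult smult]:
  fixes p :: "gen_word \<Rightarrow>\<^sub>0 'a::field"
  assumes one: "P 1"
    and gen: "\<And>g. P (free_gen g)"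
    and add: "\<And>p r. P p \<Longrightarrow> P r \<Longrightarrow> P (p + r)"
    and mult: "\<And>p r. P p \<Longrightarrow> P r \<Longrightarrow> P (p * r)"
    and smult: "\<And>c p. P p \<Longrightarrow> P (Poly_Mapping.single 0 c * p)"
  shows "P p"
proof -
  have word: "P (Poly_Mapping.single (Word w) 1)" for w
  proof (induction w)
    case Nil
    then show ?case
      using one by (simp flip: zero_gen_word_def)
  next
    case (Cons g w)
    have "Poly_Mapping.single (Word (g # w)) (1::'a) = free_gen g * Poly_Mapping.single (Word w) 1"
      by (simp add: free_gen_def mult_single)
    then show ?case
      using mult[OF gen Cons.IH] by simp
  qed
  have monomial: "P (Poly_Mapping.single w c)" for w c
  proof -
    obtain u where "w = Word u"
      by (cases w)
    then show ?thesis
      using smult[OF word[of u], of c] by (simp add: mult_single)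
  qed
  show ?thesis
  proof (induction p rule: update_induct)
    case const
    show ?case
      using monomial[of 0 0] by simp
  next
    case (update f a b)
    have "Poly_Mapping.update a b f = f + Poly_Mapping.single a b"
      using update(1)
      by (intro poly_mapping_eqI)
         (auto simp: lookup_update lookup_add lookup_single when_def in_keys_iff)
    then show ?case
      using add[OF update(3) monomial] by simp
  qed
qed

lemma q_onsager_induct [consumes 1, case_names one A As add mult smult]:
  assumes x: "x \<in> carrier (q_onsager q)"
    and one: "P \<one>\<^bsub>q_onsager q\<^esub>"
    and A: "P (onsA q)"
    and As: "P (onsAs q)"
    and add: "\<And>x y. \<lbrakk>x \<in> carrier (q_onsager q); y \<in> carrier (q_onsager q); P x; P y\<rbrakk>
      \<Longrightarrow> P (x \<oplus>\<^bsub>q_onsager q\<^esub> y)"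
    and mult: "\<And>x y. \<lbrakk>x \<in> carrier (q_onsager q); y \<in> carrier (q_onsager q); P x; P y\<rbrakk>
      \<Longrightarrow> P (x \<otimes>\<^bsub>q_onsager q\<^esub> y)"
    and smult: "\<And>c x. \<lbrakk>x \<in> carrier (q_onsager q); P x\<rbrakk> \<Longrightarrow> P (c \<odot>\<^bsub>q_onsager q\<^esub> x)"
  shows "P x"
proof -
  have "P (onsager_class q p)" for p
  proof (induction p rule: free_alg_induct)
    case (gen g)
    then show ?case
      using A As by (cases g) (simp_all add: onsA_def onsAs_def)
  next
    case (smult c p)
    then show ?case
      by (simp only: onsager_class_smult assms(7) onsager_class_carrier)
  qed (simp_all add: onsager_class_one onsager_class_add onsager_class_mult onsager_class_smult
      one add mult smult onsager_class_carrier)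
  then show ?thesis
    using x by (metis onsager_class_surj)
qed

lemma onsA_carrier: "onsA q \<in> carrier (q_onsager q)"
  and onsAs_carrier: "onsAs q \<in> carrier (q_onsager q)"
  by (simp_all add: onsA_def onsAs_def onsager_class_carrier)

section \<open>Modules for the q-Onsager algebra\<close>

lemma End_alg_simps [simp]:
  "f \<in> carrier (End_alg scale) \<longleftrightarrow> Vector_Spaces.linear scale scale f"
  "f \<otimes>\<^bsub>End_alg scale\<^esub> g = f \<circ> g" "\<one>\<^bsub>End_alg scale\<^esub> = id"
  "f \<oplus>\<^bsub>End_alg scale\<^esub> g = (\<lambda>v. f v + g v)" "c \<odot>\<^bsub>End_alg scale\<^esub> f = (\<lambda>v. scale c (f v))"
  by (simp_all add: End_alg_def)

lemma alg_moduleD: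
  assumes "alg_module R scale \<rho>"
  shows "vector_space scale"
    and "x \<in> carrier R \<Longrightarrow> Vector_Spaces.linear scale scale (\<rho> x)"
    and "\<rho> \<one>\<^bsub>R\<^esub> = id"
    and "x \<in> carrier R \<Longrightarrow> y \<in> carrier R \<Longrightarrow> \<rho> (x \<otimes>\<^bsub>R\<^esub> y) = \<rho> x \<circ> \<rho> y"
    and "x \<in> carrier R \<Longrightarrow> y \<in> carrier R \<Longrightarrow> \<rho> (x \<oplus>\<^bsub>R\<^esub> y) = (\<lambda>v. \<rho> x v + \<rho> y v)"
    and "x \<in> carrier R \<Longrightarrow> \<rho> (c \<odot>\<^bsub>R\<^esub> x) = (\<lambda>v. scale c (\<rho> x v))"
  using assms by (auto simp: alg_module_def alg_hom_def ring_hom_def Pi_iff)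

lemma alg_module_precompose:
  assumes "alg_module R scale \<rho>" and "h \<in> alg_hom R R"
  shows "alg_module R scale (\<rho> \<circ> h)"
  using assms by (auto simp: alg_module_def alg_hom_def ring_hom_def Pi_iff)

text \<open>
  The elements whose actions are intertwined by \<open>\<gamma>\<close> form a subalgebra, and it contains the
  generators.
\<close>

lemma intertwiner_from_generators:
  assumes \<sigma>: "alg_module (q_onsager q) scale \<sigma>"
    and \<tau>: "alg_module (q_onsager q) scale' \<tau>"
    and \<gamma>: "Vector_Spaces.linear scale scale' \<gamma>"
    and A: "\<gamma> \<circ> \<sigma> (onsA q) = \<tau> (onsA q) \<circ> \<gamma>"
    and As: "\<gamma> \<circ> \<sigma> (onsAs q) = \<tau> (onsAs q) \<circ> \<gamma>"
    and x: "x \<in> carrier (q_onsager q)"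
  shows "\<gamma> \<circ> \<sigma> x = \<tau> x \<circ> \<gamma>"
proof -
  interpret \<gamma>: Vector_Spaces.linear scale scale' \<gamma>
    by (rule \<gamma>)
  show ?thesis
    using x
  proof (induction x rule: q_onsager_induct)
    case (mult x y)
    then show ?case
      by (simp add: alg_moduleD(4)[OF \<sigma>] alg_moduleD(4)[OF \<tau>] fun_eq_iff)
  qed (simp_all add: A As alg_moduleD(3-6)[OF \<sigma>] alg_moduleD(3-6)[OF \<tau>] fun_eq_iff
      \<gamma>.add \<gamma>.scale)
qed

lemma invariant_from_generators:
  assumes \<rho>: "alg_module (q_onsager q) scale \<rho>"
    and U: "module.subspace scale U"
    and A: "\<rho> (onsA q) ` U \<subseteq> U"
    and As: "\<rho> (onsAs q) ` U \<subseteq> U"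
    and x: "x \<in> carrier (q_onsager q)"
  shows "\<rho> x ` U \<subseteq> U"
proof -
  interpret vector_space scale
    by (rule alg_moduleD(1)[OF \<rho>])
  show ?thesis
    using x
  proof (induction x rule: q_onsager_induct)
  qed (use A As U in \<open>auto simp: alg_moduleD(3-6)[OF \<rho>] image_subset_iff
      subspace_add subspace_scale\<close>)
qed

text \<open>
  The brackets \<open>[X,Y]\<close> and \<open>[X,Y]\<^sub>q\<close> of operators, in one formula: the coefficients are
  \<open>1, 1\<close> and \<open>q, q\<inverse>\<close>. In nested form each bracket contributes one factor
  to the scalar that a block is multiplied by.
\<close>

definition op_bracket ::
  "('a \<Rightarrow> 'v::ab_group_add \<Rightarrow> 'v) \<Rightarrow> 'a \<Rightarrow> 'a \<Rightarrow> ('v \<Rightarrow> 'v) \<Rightarrow> ('v \<Rightarrow> 'v) \<Rightarrow> 'v \<Rightarrow> 'v" where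
  "op_bracket scale b c X Y v = scale b (X (Y v)) - scale c (Y (X v))"

definition dolan_grady ::
  "('a::field \<Rightarrow> 'v::ab_group_add \<Rightarrow> 'v) \<Rightarrow> 'a \<Rightarrow> ('v \<Rightarrow> 'v) \<Rightarrow> ('v \<Rightarrow> 'v) \<Rightarrow> bool" where
  "dolan_grady scale q X Y \<longleftrightarrow>
     (\<forall>v. op_bracket scale 1 1 X (op_bracket scale (inverse q) q X
            (op_bracket scale q (inverse q) X Y)) v
          = scale ((q\<^sup>2 - inverse (q\<^sup>2))\<^sup>2) (op_bracket scale 1 1 Y X v))"

context
  fixes q :: "'a::field" and scale :: "'a \<Rightarrow> 'v::ab_group_add \<Rightarrow> 'v"
    and \<rho> :: "(gen_word \<Rightarrow>\<^sub>0 'a) set \<Rightarrow> 'v \<Rightarrow> 'v"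
  assumes \<rho>: "alg_module (q_onsager q) scale \<rho>"
begin

interpretation vector_space scale
  by (rule alg_moduleD(1)[OF \<rho>])

lemma rep_mult: "\<rho> (onsager_class q (p * r)) = \<rho> (onsager_class q p) \<circ> \<rho> (onsager_class q r)"
  by (simp add: onsager_class_mult alg_moduleD(4)[OF \<rho>] onsager_class_carrier)

lemma rep_add: "\<rho> (onsager_class q (p + r)) v = \<rho> (onsager_class q p) v + \<rho> (onsager_class q r) v"
  by (simp add: onsager_class_add alg_moduleD(5)[OF \<rho>] onsager_class_carrier)

lemma rep_smult:
  "\<rho> (onsager_class q (Poly_Mapping.single 0 c * p)) v = scale c (\<rho> (onsager_class q p) v)"
  by (simp add: onsager_class_smult alg_moduleD(6)[OF \<rho>] onsager_class_carrier)

lemma rep_diff: "\<rho> (onsager_class q (p - r)) v = \<rho> (onsager_class q p) v - \<rho> (onsager_class q r) v"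
  using rep_add[of "p - r" r v] by simp

lemma rep_comm:
  "\<rho> (onsager_class q (comm free_alg p r)) =
     op_bracket scale 1 1 (\<rho> (onsager_class q p)) (\<rho> (onsager_class q r))"
  by (simp add: comm_def op_bracket_def rep_diff rep_mult fun_eq_iff)

lemma rep_qcomm:
  "\<rho> (onsager_class q (qcomm free_alg c p r)) =
     op_bracket scale c (inverse c) (\<rho> (onsager_class q p)) (\<rho> (onsager_class q r))"
  unfolding fun_eq_iff qcomm_def op_bracket_def free_alg_minus free_alg_simps rep_diff rep_smult
  by (simp add: rep_mult)

text \<open>
  The class of the relator is the class of \<open>0\<close>, which acts as \<open>0\<close>.
\<close>

lemma rep_dolan_grady_of_relator:
  assumes "onsager_relator free_alg q p r \<in> onsager_ideal q"
  shows "dolan_grady scale q (\<rho> (onsager_class q p)) (\<rho> (onsager_class q r))"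
proof -
  have "onsager_class q (onsager_relator free_alg q p r) = onsager_class q 0"
    by (rule onsager_class_eqI) (use assms in simp)
  moreover have "\<rho> (onsager_class q 0) v = 0" for v
    using rep_diff[of 0 0 v] by simp
  ultimately have "\<rho> (onsager_class q (onsager_relator free_alg q p r)) v = 0" for v
    by simp
  then show ?thesis
    unfolding dolan_grady_def onsager_relator_def
    by (simp add: rep_diff rep_smult rep_comm rep_qcomm)
qed

lemma rep_dolan_grady:
  "dolan_grady scale q (\<rho> (onsA q)) (\<rho> (onsAs q))"
  "dolan_grady scale q (\<rho> (onsAs q)) (\<rho> (onsA q))"
proof -
  have *: "{onsager_relator free_alg q (free_gen GenA) (free_gen GenAs),
      onsager_relator free_alg q (free_gen GenAs) (free_gen GenA)} \<subseteq> onsager_ideal q"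
    unfolding onsager_ideal_def
    by (rule ring.genideal_self[OF ring_free_alg]) simp
  then show "dolan_grady scale q (\<rho> (onsA q)) (\<rho> (onsAs q))"
    "dolan_grady scale q (\<rho> (onsAs q)) (\<rho> (onsA q))"
    unfolding onsA_def onsAs_def by (auto intro!: rep_dolan_grady_of_relator)
qed

lemma rep_lusztig:
  assumes "lusztig_automorphism q L"
  shows "\<rho> (L (onsAs q)) v = \<rho> (onsAs q) v
    + scale (inverse ((q - inverse q) * (q\<^sup>2 - inverse (q\<^sup>2))))
        (op_bracket scale 1 1 (\<rho> (onsA q))
          (op_bracket scale q (inverse q) (\<rho> (onsA q)) (\<rho> (onsAs q))) v)"
proof -
  define k where "k = inverse ((q - inverse q) * (q\<^sup>2 - inverse (q\<^sup>2)))"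
  let ?A = "free_gen GenA" and ?As = "free_gen GenAs"
  have "L (onsAs q) = onsager_class q
      (?As + Poly_Mapping.single 0 k * comm free_alg ?A (qcomm free_alg q ?A ?As))"
    using assms
    by (simp only: lusztig_automorphism_def onsA_def onsAs_def onsager_class_add
        onsager_class_smult onsager_class_comm onsager_class_qcomm k_def)
  then show ?thesis
    by (simp only: rep_add rep_smult rep_comm rep_qcomm onsA_def onsAs_def k_def)
qed

end

section \<open>Eigenspace decompositions\<close>

context vector_space
begin

lemma subspace_eigenspace:
  assumes "Vector_Spaces.linear scale scale T"
  shows "subspace (eigenspace scale T c)"
proof -
  interpret T: Vector_Spaces.linear scale scale T
    by (rule assms)
  show ?thesis
    by (auto simp: subspace_def eigenspace_def T.zero T.add T.scale scale_right_distrib mult.commute)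
qed

text \<open>
  Eigenvectors for distinct eigenvalues are independent. For the inductive step, applying
  \<open>T - m\<close> removes the term for \<open>m\<close> and multiplies the others by nonzero scalars.
\<close>

lemma eigenvectors_sum_eq_0:
  assumes T: "Vector_Spaces.linear scale scale T"
    and "finite M"
    and "\<And>c. c \<in> M \<Longrightarrow> w c \<in> eigenspace scale T c"
    and "sum w M = 0"
    and "c \<in> M"
  shows "w c = 0"
  using assms(2-)
proof (induction M arbitrary: w c)
  case empty
  then show ?case
    by simp
next
  case (insert m M)
  interpret T: Vector_Spaces.linear scale scale T
    by (rule T)
  have Tw: "T (w c) = c *s w c" if "c \<in> insert m M" for c
    using insert.prems(1)[OF that] by (simp add: eigenspace_def)
  have "0 = T (sum w (insert m M)) - m *s sum w (insert m M)"
    by (simp add: insert.prems(2) T.zero)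
  also have "\<dots> = (\<Sum>c\<in>insert m M. (c - m) *s w c)"
    by (simp add: T.sum Tw scale_sum_right scale_left_diff_distrib flip: sum_subtractf)
  also have "\<dots> = (\<Sum>c\<in>M. (c - m) *s w c)"
    using insert.hyps by simp
  finally have sum0: "(\<Sum>c\<in>M. (c - m) *s w c) = 0"
    by simp
  have M0: "w c = 0" if "c \<in> M" for c
  proof -
    have "(c - m) *s w c = 0"
    proof (rule insert.IH[of "\<lambda>c. (c - m) *s w c", OF _ sum0 that])
      fix c assume "c \<in> M"
      then show "(c - m) *s w c \<in> eigenspace scale T c"
        using insert.prems(1)[of c] subspace_scale[OF subspace_eigenspace[OF T]] by blast
    qed
    then show ?thesis
      using that insert.hyps by auto
  qed
  then have "w m = 0"
    using insert.prems(2) insert.hyps by simp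
  then show ?case
    using M0 insert.prems(3) by auto
qed

lemma span_eigenspaces_decompose:
  assumes T: "Vector_Spaces.linear scale scale T"
    and C: "finite C"
    and v: "v \<in> span (\<Union>c\<in>C. eigenspace scale T c)"
  obtains w where "\<And>c. c \<in> C \<Longrightarrow> w c \<in> eigenspace scale T c" and "v = sum w C"
proof -
  let ?P = "\<lambda>v. \<exists>w. (\<forall>c\<in>C. w c \<in> eigenspace scale T c) \<and> v = sum w C"
  note sub = subspace_eigenspace[OF T]
  have "?P v"
    using v
  proof (rule span_induct)
    show "subspace (Collect ?P)"
    proof (rule subspaceI)
      show "0 \<in> Collect ?P"
        using subspace_0[OF sub] by (auto intro!: exI[of _ "\<lambda>_. 0"])
    next
      fix x y assume "x \<in> Collect ?P" "y \<in> Collect ?P"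
      then obtain f g where "\<forall>c\<in>C. f c \<in> eigenspace scale T c" "x = sum f C"
        "\<forall>c\<in>C. g c \<in> eigenspace scale T c" "y = sum g C"
        by auto
      then show "x + y \<in> Collect ?P"
        using subspace_add[OF sub]
        by (auto intro!: exI[of _ "\<lambda>c. f c + g c"] simp: sum.distrib)
    next
      fix k x assume "x \<in> Collect ?P"
      then obtain f where "\<forall>c\<in>C. f c \<in> eigenspace scale T c" "x = sum f C"
        by auto
      then show "k *s x \<in> Collect ?P"
        using subspace_scale[OF sub]
        by (auto intro!: exI[of _ "\<lambda>c. k *s f c"] simp: scale_sum_right)
    qed
  next
    fix x assume "x \<in> (\<Union>c\<in>C. eigenspace scale T c)"
    then obtain c where c: "c \<in> C" "x \<in> eigenspace scale T c"
      by auto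
    then show "?P x"
      using C subspace_0[OF sub]
      by (auto intro!: exI[of _ "\<lambda>b. if b = c then x else 0"])
  qed
  then show ?thesis
    using that by blast
qed

text \<open>
  An eigenvector for a further eigenvalue would be a sum of eigenvectors for the eigenvalues in
  \<open>M\<close>, against independence.
\<close>

lemma eigenvalues_eq_of_span:
  assumes T: "Vector_Spaces.linear scale scale T"
    and M: "finite M" "M \<subseteq> eigenvalues scale T"
    and span: "span (\<Union>c\<in>M. eigenspace scale T c) = UNIV"
  shows "M = eigenvalues scale T"
proof (rule antisym[OF M(2)], rule subsetI, rule ccontr)
  fix m assume m: "m \<in> eigenvalues scale T" "m \<notin> M"
  then obtain v where v: "v \<noteq> 0" "v \<in> eigenspace scale T m"
    by (auto simp: eigenvalues_def eigenspace_def)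
  obtain w where w: "\<And>c. c \<in> M \<Longrightarrow> w c \<in> eigenspace scale T c" "v = sum w M"
    using span_eigenspaces_decompose[OF T M(1), of v] span by auto
  let ?w = "w(m := - v)"
  have "sum ?w M = sum w M"
    using m(2) by (intro sum.cong) auto
  then have sum0: "sum ?w (insert m M) = 0"
    using M(1) m(2) w(2) by simp
  have "?w c \<in> eigenspace scale T c" if "c \<in> insert m M" for c
    using that w(1) v(2) subspace_neg[OF subspace_eigenspace[OF T]] by auto
  then have "?w m = 0"
    using eigenvectors_sum_eq_0[OF T, of "insert m M" ?w m] M(1) sum0 by blast
  then show False
    using v(1) by simp
qed

text \<open>
  Each vector of a finite basis involves only finitely many eigenvalues, and the eigenspaces for
  these already span.
\<close>

lemma finite_eigenvalues:
  assumes T: "Vector_Spaces.linear scale scale T"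
    and diag: "diagonalizable scale T"
    and fin: "finite_dim scale"
  shows "finite (eigenvalues scale T)"
proof -
  let ?E = "\<lambda>C. \<Union>c\<in>C. eigenspace scale T c"
  have ex: "\<exists>M. finite M \<and> M \<subseteq> eigenvalues scale T \<and> v \<in> span (?E M)" for v
  proof -
    have "v \<in> span (?E (eigenvalues scale T))"
      using diag by (simp add: diagonalizable_def)
    then obtain t r where t: "finite t" "t \<subseteq> ?E (eigenvalues scale T)" "v = (\<Sum>a\<in>t. r a *s a)"
      unfolding span_explicit by blast
    from t(2) obtain f where f: "\<And>a. a \<in> t \<Longrightarrow> f a \<in> eigenvalues scale T \<and> a \<in> eigenspace scale T (f a)"
      using bchoice[of t "\<lambda>a c. c \<in> eigenvalues scale T \<and> a \<in> eigenspace scale T c"] by blast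
    define M where "M = f ` t"
    have M: "finite M" "M \<subseteq> eigenvalues scale T" "t \<subseteq> ?E M"
      using t(1) f by (auto simp: M_def)
    have "v \<in> span (?E M)"
      unfolding t(3) using M(3) by (intro span_sum span_scale) (auto intro: span_base)
    then show ?thesis
      using M by blast
  qed
  then obtain M where M: "\<And>v. finite (M v)" "\<And>v. M v \<subseteq> eigenvalues scale T"
    "\<And>v. v \<in> span (?E (M v))"
    by metis
  obtain B where "finite_dimensional_vector_space scale B"
    using fin by (auto simp: finite_dim_def)
  then have B: "finite B" "span B = UNIV"
    by (auto simp: finite_dimensional_vector_space_def finite_dimensional_vector_space_axioms_def)
  let ?M = "\<Union>b\<in>B. M b"
  have "B \<subseteq> span (?E ?M)"
  proof
    fix b assume "b \<in> B"
    then have "span (?E (M b)) \<subseteq> span (?E ?M)"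
      by (intro span_mono) auto
    then show "b \<in> span (?E ?M)"
      using M(3) by blast
  qed
  then have "span (?E ?M) = UNIV"
    using B(2) span_minimal[OF _ subspace_span] by blast
  then have "?M = eigenvalues scale T"
    using B(1) M(1,2) by (intro eigenvalues_eq_of_span[OF T]) auto
  then show ?thesis
    using B(1) M(1) by (metis finite_UN_I)
qed

lemma diagonalizable_decompose:
  assumes T: "Vector_Spaces.linear scale scale T"
    and "diagonalizable scale T"
    and "finite (eigenvalues scale T)"
  obtains w where "\<And>c. c \<in> eigenvalues scale T \<Longrightarrow> w c \<in> eigenspace scale T c"
    and "v = sum w (eigenvalues scale T)"
  using span_eigenspaces_decompose[OF T assms(3), of v] assms(2)
  by (auto simp: diagonalizable_def)

lemma linear_op_bracket:
  assumes "Vector_Spaces.linear scale scale X" "Vector_Spaces.linear scale scale Y"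
  shows "Vector_Spaces.linear scale scale (op_bracket scale b c X Y)"
proof -
  interpret X: Vector_Spaces.linear scale scale X by (rule assms)
  interpret Y: Vector_Spaces.linear scale scale Y by (rule assms)
  show ?thesis
    by unfold_locales
      (simp_all add: op_bracket_def X.add Y.add X.scale Y.scale scale_right_distrib
        scale_right_diff_distrib algebra_simps)
qed

text \<open>
  The computation behind everything else: on an eigenvector, a bracket with \<open>T\<close> rescales each
  component of the image. It can be iterated because the rescaled components lie in the same
  eigenspaces.
\<close>

lemma op_bracket_eigenvector:
  assumes T: "Vector_Spaces.linear scale scale T"
    and X: "Vector_Spaces.linear scale scale X"
    and v: "v \<in> eigenspace scale T \<nu>"
    and w: "\<And>\<mu>. \<mu> \<in> C \<Longrightarrow> w \<mu> \<in> eigenspace scale T \<mu>"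
    and Xv: "X v = sum w C"
  shows "op_bracket scale b c T X v = (\<Sum>\<mu>\<in>C. (b * \<mu> - c * \<nu>) *s w \<mu>)"
proof -
  interpret T: Vector_Spaces.linear scale scale T by (rule T)
  interpret X: Vector_Spaces.linear scale scale X by (rule X)
  have "T v = \<nu> *s v" and "T (sum w C) = (\<Sum>\<mu>\<in>C. \<mu> *s w \<mu>)"
    using v w by (auto simp: eigenspace_def T.sum)
  then show ?thesis
    by (simp add: op_bracket_def X.scale Xv scale_sum_right scale_left_diff_distrib
        flip: sum_subtractf)
qed

end

section \<open>Adjacency of eigenvalues\<close>

text \<open>
  The quadratic factor that remains of the cubic relation, read on the block from the
  \<open>\<nu>\<close>-eigenspace to the \<open>\<mu>\<close>-eigenspace, after division by \<open>\<mu> - \<nu>\<close>.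
\<close>

definition q_adjacent :: "'a::field \<Rightarrow> 'a \<Rightarrow> 'a \<Rightarrow> bool" where
  "q_adjacent q \<mu> \<nu> \<longleftrightarrow>
     \<mu>\<^sup>2 - (q\<^sup>2 + inverse (q\<^sup>2)) * \<mu> * \<nu> + \<nu>\<^sup>2 + (q\<^sup>2 - inverse (q\<^sup>2))\<^sup>2 = 0"

lemma q_adjacent_sym: "q_adjacent q \<mu> \<nu> \<longleftrightarrow> q_adjacent q \<nu> \<mu>"
  by (simp add: q_adjacent_def algebra_simps)

text \<open>
  Three applications of \<open>op_bracket_eigenvector\<close> turn the relation into a sum of eigenvectors
  that vanishes, so each summand vanishes.
\<close>

lemma (in vector_space) dolan_grady_adjacent:
  assumes q: "q \<noteq> 0"
    and T: "Vector_Spaces.linear scale scale T"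
    and S: "Vector_Spaces.linear scale scale S"
    and DG: "dolan_grady scale q T S"
    and v: "v \<in> eigenspace scale T \<nu>"
    and C: "finite C"
    and w: "\<And>\<mu>. \<mu> \<in> C \<Longrightarrow> w \<mu> \<in> eigenspace scale T \<mu>"
    and Sv: "S v = sum w C"
    and \<mu>: "\<mu> \<in> C" "w \<mu> \<noteq> 0"
  shows "\<mu> = \<nu> \<or> q_adjacent q \<mu> \<nu>"
proof -
  let ?\<gamma> = "(q\<^sup>2 - inverse (q\<^sup>2))\<^sup>2"
  let ?X1 = "op_bracket scale q (inverse q) T S"
  let ?X2 = "op_bracket scale (inverse q) q T ?X1"
  let ?w1 = "\<lambda>\<mu>. (q * \<mu> - inverse q * \<nu>) *s w \<mu>"
  let ?w2 = "\<lambda>\<mu>. (inverse q * \<mu> - q * \<nu>) *s ?w1 \<mu>"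
  let ?w3 = "\<lambda>\<mu>. (1 * \<mu> - 1 * \<nu>) *s ?w2 \<mu>"
  let ?g = "\<lambda>\<mu>. (\<mu> - \<nu>) * (inverse q * \<mu> - q * \<nu>) * (q * \<mu> - inverse q * \<nu>) + ?\<gamma> * (\<mu> - \<nu>)"
  note bracket = op_bracket_eigenvector[OF T _ v]
  note lin = linear_op_bracket[OF T]
  have w1: "?w1 \<mu> \<in> eigenspace scale T \<mu>" and w2: "?w2 \<mu> \<in> eigenspace scale T \<mu>" if "\<mu> \<in> C" for \<mu>
    using that w subspace_scale[OF subspace_eigenspace[OF T]] by blast+
  have X1: "?X1 v = sum ?w1 C"
    by (rule bracket[OF S w Sv])
  have X2: "?X2 v = sum ?w2 C"
    by (rule bracket[OF lin[OF S] w1 X1])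
  have X3: "op_bracket scale 1 1 T ?X2 v = sum ?w3 C"
    by (rule bracket[OF lin[OF lin[OF S]] w2 X2])
  have "op_bracket scale 1 1 S T v = - op_bracket scale 1 1 T S v"
    by (simp add: op_bracket_def)
  also have "\<dots> = - (\<Sum>\<mu>\<in>C. (1 * \<mu> - 1 * \<nu>) *s w \<mu>)"
    by (simp only: bracket[OF S w Sv])
  finally have "sum ?w3 C = ?\<gamma> *s - (\<Sum>\<mu>\<in>C. (1 * \<mu> - 1 * \<nu>) *s w \<mu>)"
    using DG X3 unfolding dolan_grady_def by metis
  then have "sum ?w3 C + ?\<gamma> *s (\<Sum>\<mu>\<in>C. (1 * \<mu> - 1 * \<nu>) *s w \<mu>) = 0"
    by simp
  also have "sum ?w3 C + ?\<gamma> *s (\<Sum>\<mu>\<in>C. (1 * \<mu> - 1 * \<nu>) *s w \<mu>) = (\<Sum>\<mu>\<in>C. ?g \<mu> *s w \<mu>)"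
    by (simp add: scale_sum_right scale_left_distrib mult.assoc flip: sum.distrib)
  finally have "?g \<mu> *s w \<mu> = 0"
    using eigenvectors_sum_eq_0[OF T C, of "\<lambda>\<mu>. ?g \<mu> *s w \<mu>"] \<mu>(1) w
      subspace_scale[OF subspace_eigenspace[OF T]] by blast
  then have "?g \<mu> = 0"
    using \<mu>(2) by simp
  also have "?g \<mu> = (\<mu> - \<nu>) *
      (\<mu>\<^sup>2 - (q\<^sup>2 + inverse (q\<^sup>2)) * \<mu> * \<nu> + \<nu>\<^sup>2 + (q\<^sup>2 - inverse (q\<^sup>2))\<^sup>2)"
    using q by (simp add: field_simps power2_eq_square)
  finally show ?thesis
    by (auto simp: q_adjacent_def)
qed

lemma q_adjacent_Vieta:
  assumes "q_adjacent q \<mu> \<nu>" "q_adjacent q \<mu>' \<nu>" "\<mu> \<noteq> \<mu>'"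
  shows "\<mu> + \<mu>' = (q\<^sup>2 + inverse (q\<^sup>2)) * \<nu>"
proof -
  let ?f = "\<lambda>\<mu>. \<mu>\<^sup>2 - (q\<^sup>2 + inverse (q\<^sup>2)) * \<mu> * \<nu> + \<nu>\<^sup>2 + (q\<^sup>2 - inverse (q\<^sup>2))\<^sup>2"
  have "(\<mu> - \<mu>') * (\<mu> + \<mu>' - (q\<^sup>2 + inverse (q\<^sup>2)) * \<nu>) = ?f \<mu> - ?f \<mu>'"
    by (simp add: algebra_simps power2_eq_square)
  also have "\<dots> = 0"
    using assms(1,2) by (simp add: q_adjacent_def)
  finally show ?thesis
    using assms(3) by simp
qed

text \<open>
  Each eigenvalue has at most two neighbours: two distinct roots of a quadratic polynomial
  determine each other through their sum.
\<close>

lemma q_adjacent_at_most_two: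
  assumes "q_adjacent q \<mu>1 \<nu>" "q_adjacent q \<mu>2 \<nu>" "q_adjacent q \<mu>3 \<nu>"
  shows "\<mu>1 = \<mu>2 \<or> \<mu>1 = \<mu>3 \<or> \<mu>2 = \<mu>3"
  using q_adjacent_Vieta[of q \<mu>1 \<nu> \<mu>2] q_adjacent_Vieta[of q \<mu>1 \<nu> \<mu>3] assms
  by (metis add_left_cancel)

text \<open>
  Along a cycle, the sum of the roots gives
  \<open>x\<^sub>i\<^sub>-\<^sub>1 + x\<^sub>i\<^sub>+\<^sub>1 = (p + p\<inverse>) x\<^sub>i\<close> with \<open>p = q\<^sup>2\<close>, indices taken modulo
  \<open>n + 1\<close>. The differences \<open>u\<^sub>i = x\<^sub>i\<^sub>+\<^sub>1 - p x\<^sub>i\<close> form a geometric sequence with ratio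
  \<open>p\<inverse>\<close>; being periodic they vanish, as \<open>p\<close> is not a root of unity. So the \<open>x\<^sub>i\<close> form
  a geometric sequence with ratio \<open>p\<close>, and vanish for the same reason.
\<close>

lemma not_q_adjacent_cycle:
  fixes x :: "nat \<Rightarrow> 'a::field"
  assumes q: "q \<noteq> 0" "\<And>n::nat. n > 0 \<Longrightarrow> q ^ n \<noteq> 1"
    and inj: "inj_on x {..n}" and n: "n \<ge> 2"
    and path: "\<And>i. i < n \<Longrightarrow> q_adjacent q (x i) (x (Suc i))"
    and ends: "q_adjacent q (x 0) (x n)"
  shows False
proof -
  define p where "p = q\<^sup>2"
  have p: "p \<noteq> 0" "p ^ Suc n \<noteq> 1"
    using q(1) q(2)[of "2 * Suc n"] by (simp_all add: p_def power_mult del: mult_Suc_right)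
  have ne: "x i \<noteq> x j" if "i \<le> n" "j \<le> n" "i \<noteq> j" for i j
    using inj that by (auto simp: inj_on_def)
  have rec: "x (Suc (Suc i)) = (p + inverse p) * x (Suc i) - x i" if "Suc i < n" for i
    using q_adjacent_Vieta[of q "x i" "x (Suc i)" "x (Suc (Suc i))"] path[of i] path[of "Suc i"]
      ne[of i "Suc (Suc i)"] that
    by (simp add: p_def q_adjacent_sym[of q "x (Suc i)" "x (Suc (Suc i))"] algebra_simps)
  have rec0: "x 1 = (p + inverse p) * x 0 - x n"
    using q_adjacent_Vieta[of q "x 1" "x 0" "x n"] path[of 0] ends ne[of 1 n] n
    by (simp add: p_def q_adjacent_sym[of q "x 0"] algebra_simps)
  obtain m where m: "n = Suc m"
    using n by (cases n) auto
  have recn: "x 0 = (p + inverse p) * x n - x m"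
    using q_adjacent_Vieta[of q "x 0" "x n" "x m"] path[of m] ends ne[of 0 m] n
    by (simp add: p_def m algebra_simps)
  define u where "u i = (if i < n then x (Suc i) else x 0) - p * x i" for i
  have step: "p * u (Suc i) = u i" if "i < n" for i
  proof (cases "Suc i < n")
    case True
    then show ?thesis
      using p(1) by (simp add: u_def rec field_simps)
  next
    case False
    then have "i = m"
      using that m by simp
    then show ?thesis
      using p(1) recn by (simp add: u_def m field_simps)
  qed
  have "p * u 0 = u n"
    using p(1) rec0 n by (simp add: u_def field_simps)
  moreover have pow: "p ^ i * u i = u 0" if "i \<le> n" for i
    using that
  proof (induction i)
    case (Suc i)
    have "p ^ Suc i * u (Suc i) = p ^ i * (p * u (Suc i))"
      by (simp add: mult_ac)
    then show ?case
      using step[of i] Suc by simp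
  qed simp
  ultimately have "p ^ Suc n * u 0 = u 0"
    using pow[of n] by (metis le_refl mult.assoc power_Suc2)
  then have "u 0 = 0"
    using p(2) by simp
  then have u0: "u i = 0" if "i \<le> n" for i
    using pow[OF that] p(1) by simp
  have pow_x: "x i = p ^ i * x 0" if "i \<le> n" for i
    using that
  proof (induction i)
    case (Suc i)
    then show ?case
      using u0[of i] by (simp add: u_def mult.assoc)
  qed simp
  have "x 0 = p ^ Suc n * x 0"
    using u0[of n] pow_x[of n] by (simp add: u_def mult.assoc)
  then have "x 0 = 0"
    using p(2) by simp
  then have "x 1 = x 0"
    using pow_x[of 1] n by simp
  then show False
    using ne[of 1 0] n by simp
qed

text \<open>
  A longest path visits all of \<open>V\<close>: a new neighbour of an endpoint would prolong it, and a new
  neighbour of an inner vertex would be its third one. The same count excludes all chords except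
  the one between the two ends, which would close a cycle. Since \<open>q_adjacent\<close> may hold between
  an eigenvalue and itself, only distinct indices are considered.
\<close>

lemma q_adjacent_path:
  fixes V :: "'a::field set"
  assumes q: "q \<noteq> 0" "\<And>n::nat. n > 0 \<Longrightarrow> q ^ n \<noteq> 1"
    and V: "finite V" "V \<noteq> {}"
    and connected: "\<And>M. \<lbrakk>M \<subseteq> V; M \<noteq> {};
        \<And>\<mu> \<nu>. \<lbrakk>\<mu> \<in> V; \<nu> \<in> M; q_adjacent q \<mu> \<nu>\<rbrakk> \<Longrightarrow> \<mu> \<in> M\<rbrakk> \<Longrightarrow> M = V"
  obtains n x where "inj_on x {..n}" and "x ` {..n} = V"
    and "\<And>i j. \<lbrakk>i \<le> n; j \<le> n; i \<noteq> j; q_adjacent q (x i) (x j)\<rbrakk> \<Longrightarrow> i = Suc j \<or> j = Suc i"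
proof -
  define path :: "nat \<Rightarrow> (nat \<Rightarrow> 'a) \<Rightarrow> bool" where
    "path n x \<longleftrightarrow> inj_on x {..n} \<and> x ` {..n} \<subseteq> V \<and> (\<forall>i<n. q_adjacent q (x i) (x (Suc i)))" for n x
  let ?N = "{n. \<exists>x. path n x}"
  have bound: "n < card V" if "path n x" for n x
  proof -
    have "card {..n} \<le> card V"
      using that V(1) by (intro card_inj_on_le[of x]) (auto simp: path_def)
    then show ?thesis
      by simp
  qed
  obtain v where "v \<in> V"
    using V(2) by blast
  then have "path 0 (\<lambda>_. v)"
    by (simp add: path_def)
  then have N: "finite ?N" "?N \<noteq> {}"
    using bound by (auto intro!: finite_subset[of ?N "{..<card V}"])
  define n where "n = Max ?N"
  have "n \<in> ?N"
    unfolding n_def using N by (rule Max_in)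
  then obtain x where x: "path n x"
    by blast
  have longest: "\<not> path (Suc n) y" for y
    using Max_ge[OF N(1), of "Suc n"] by (auto simp: n_def)
  have inj: "inj_on x {..n}" and sub: "x ` {..n} \<subseteq> V"
    and adj: "\<And>i. i < n \<Longrightarrow> q_adjacent q (x i) (x (Suc i))"
    using x by (auto simp: path_def)
  have ne: "x i \<noteq> x j" if "i \<le> n" "j \<le> n" "i \<noteq> j" for i j
    using inj that by (auto simp: inj_on_def)
  have inner: "\<mu> = x (i - 1) \<or> \<mu> = x (Suc i)" if "0 < i" "i < n" "q_adjacent q \<mu> (x i)" for \<mu> i
    using q_adjacent_at_most_two[of q \<mu> "x i" "x (i - 1)" "x (Suc i)"]
      adj[of "i - 1"] adj[of i] ne[of "i - 1" "Suc i"] that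
    by (auto simp: q_adjacent_sym[of q "x i" "x (Suc i)"])
  have image: "x ` {..n} = V"
  proof (rule connected[OF sub])
    show "x ` {..n} \<noteq> {}"
      by auto
    fix \<mu> \<nu>
    assume \<mu>: "\<mu> \<in> V" and "\<nu> \<in> x ` {..n}" and \<mu>\<nu>: "q_adjacent q \<mu> \<nu>"
    then obtain i where i: "i \<le> n" "\<nu> = x i"
      by blast
    show "\<mu> \<in> x ` {..n}"
    proof (rule ccontr)
      assume new: "\<mu> \<notin> x ` {..n}"
      consider "i = n" | "i = 0" | "0 < i" "i < n"
        using i(1) by linarith
      then show False
      proof cases
        case 1
        have "path (Suc n) (x(Suc n := \<mu>))"
          using inj sub adj \<mu> \<mu>\<nu> i 1 new
          by (auto simp: path_def inj_on_def image_subset_iff less_Suc_eq le_Suc_eq image_iff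
              q_adjacent_sym[of q "x n" \<mu>])
        then show False
          using longest by blast
      next
        case 2
        have "path (Suc n) (case_nat \<mu> x)"
          unfolding path_def
        proof (intro conjI allI impI)
          show "inj_on (case_nat \<mu> x) {..Suc n}"
            using inj new by (auto simp: inj_on_def image_iff split: nat.splits)
          show "case_nat \<mu> x ` {..Suc n} \<subseteq> V"
            using sub \<mu> by (auto simp: image_subset_iff split: nat.splits)
          show "q_adjacent q (case_nat \<mu> x k) (case_nat \<mu> x (Suc k))" if "k < Suc n" for k
            using that adj \<mu>\<nu> i 2 by (cases k) auto
        qed
        then show False
          using longest by blast
      next
        case 3
        then show False
          using inner[of i \<mu>] \<mu>\<nu> i new by auto
      qed
    qed
  qed
  have upward: "j = Suc i" if ij: "i < j" "j \<le> n" "q_adjacent q (x i) (x j)" for i j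
  proof (rule ccontr)
    assume "j \<noteq> Suc i"
    consider "0 < i" | "j < n" | "i = 0" "j = n"
      using ij by linarith
    then show False
    proof cases
      case 1
      have "x j \<noteq> x (i - 1)" "x j \<noteq> x (Suc i)"
        by (rule ne; use ij \<open>j \<noteq> Suc i\<close> in linarith)+
      then show False
        using inner[of i "x j"] 1 ij by (simp add: q_adjacent_sym[of q "x j"])
    next
      case 2
      have "x i \<noteq> x (j - 1)" "x i \<noteq> x (Suc j)"
        by (rule ne; use ij 2 \<open>j \<noteq> Suc i\<close> in linarith)+
      then show False
        using inner[of j "x i"] 2 ij by simp
    next
      case 3
      then show False
        using not_q_adjacent_cycle[OF q inj _ adj] ij \<open>j \<noteq> Suc i\<close> by auto
    qed
  qed
  show ?thesis
  proof (rule that[OF inj image])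
    fix i j
    assume "i \<le> n" "j \<le> n" "i \<noteq> j" "q_adjacent q (x i) (x j)"
    then show "i = Suc j \<or> j = Suc i"
      using upward[of i j] upward[of j i] q_adjacent_sym[of q "x i"] by (metis linorder_neqE_nat)
  qed
qed

section \<open>Tridiagonal pairs from the cubic relations\<close>

text \<open>
  By \<open>dolan_grady_adjacent\<close>, the operator \<open>S\<close> sends an eigenvector for \<open>x\<^sub>j\<close> to a sum of
  eigenvectors for \<open>x\<^sub>j\<close> and adjacent eigenvalues, which lie next to it in the order \<open>x\<close>.
\<close>

lemma tridiagonal_orderingI:
  fixes scale :: "'a::field \<Rightarrow> 'v::ab_group_add \<Rightarrow> 'v"
  assumes q: "q \<noteq> 0"
    and T: "Vector_Spaces.linear scale scale T"
    and S: "Vector_Spaces.linear scale scale S"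
    and diag: "diagonalizable scale T"
    and DG: "dolan_grady scale q T S"
    and inj: "inj_on x {..n}"
    and image: "x ` {..n} = eigenvalues scale T"
    and step: "\<And>i j. \<lbrakk>i \<le> n; j \<le> n; i \<noteq> j; q_adjacent q (x i) (x j)\<rbrakk> \<Longrightarrow> i = Suc j \<or> j = Suc i"
  shows "tridiagonal_ordering scale T S n
    (\<lambda>i. if 0 \<le> i \<and> i \<le> int n then eigenspace scale T (x (nat i)) else {0})"
proof -
  interpret vector_space scale
    using T by (simp add: Vector_Spaces.linear_def)
  interpret T: Vector_Spaces.linear scale scale T by (rule T)
  let ?W = "\<lambda>i. if 0 \<le> i \<and> i \<le> int n then eigenspace scale T (x (nat i)) else {0}"
  have inj_eig: "inj_on (eigenspace scale T) (eigenvalues scale T)"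
  proof (rule inj_onI)
    fix c c' assume "c \<in> eigenvalues scale T" and eq: "eigenspace scale T c = eigenspace scale T c'"
    then obtain v where v: "v \<noteq> 0" "v \<in> eigenspace scale T c"
      by (auto simp: eigenvalues_def eigenspace_def)
    moreover have "v \<in> eigenspace scale T c'"
      using v(2) eq by simp
    ultimately have "scale c v = scale c' v"
      by (simp add: eigenspace_def)
    then show "c = c'"
      using v(1) by simp
  qed
  have "bij_betw (eigenspace scale T \<circ> (x \<circ> nat)) {0..int n} (eigenspace scale T ` eigenvalues scale T)"
  proof (intro bij_betw_trans)
    show "bij_betw nat {0..int n} {..n}"
      by (rule bij_betw_byWitness[where f' = int]) auto
    show "bij_betw x {..n} (eigenvalues scale T)"
      using inj image by (simp add: bij_betw_def)
    show "bij_betw (eigenspace scale T) (eigenvalues scale T) (eigenspace scale T ` eigenvalues scale T)"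
      using inj_eig by (simp add: bij_betw_def)
  qed
  then have bij: "bij_betw ?W {0..int n} (eigenspace scale T ` eigenvalues scale T)"
    by (rule bij_betw_cong[THEN iffD1, rotated]) auto
  have fin: "finite (eigenvalues scale T)"
    using image by (metis finite_atMost finite_imageI)
  have "S ` ?W i \<subseteq> {a + b + c | a b c. a \<in> ?W (i - 1) \<and> b \<in> ?W i \<and> c \<in> ?W (i + 1)}"
    if "i \<in> {0..int n}" for i
  proof (rule image_subsetI)
    fix v assume v: "v \<in> ?W i"
    define j where "j = nat i"
    have j: "i = int j" "j \<le> n"
      using that by (auto simp: j_def)
    have vj: "v \<in> eigenspace scale T (x j)"
      using v j by auto
    obtain w where w: "\<And>c. c \<in> eigenvalues scale T \<Longrightarrow> w c \<in> eigenspace scale T c"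
      and Sv: "S v = sum w (eigenvalues scale T)"
      using diagonalizable_decompose[OF T diag fin] by blast
    define y where "y k = w (x k)" for k
    have y_in: "y k \<in> ?W (int k)" if "k \<le> n" for k
      using w[of "x k"] that image by (auto simp: y_def)
    have Sy: "S v = (\<Sum>k\<le>n. y k)"
      unfolding Sv image[symmetric] using inj by (simp add: sum.reindex y_def)
    have y0: "y k = 0" if "k \<le> n" "k \<noteq> j" "Suc k \<noteq> j" "k \<noteq> Suc j" for k
    proof (rule ccontr)
      assume "y k \<noteq> 0"
      then have "x k = x j \<or> q_adjacent q (x k) (x j)"
        using dolan_grady_adjacent[OF q T S DG vj fin w Sv, of "x k"] that(1) image
        by (auto simp: y_def)
      then show False
        using step[of k j] inj that j(2) by (auto simp: inj_on_def)
    qed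
    \<comment> \<open>Each sum has at most one nonzero term, the component of \<open>S v\<close> just below or just above
      \<open>j\<close>; at an end of the ordering it is \<open>0\<close>, the only element of \<open>?W\<close> there.\<close>
    define a where "a = (\<Sum>k\<le>n. if Suc k = j then y k else 0)"
    define c where "c = (\<Sum>k\<le>n. if k = Suc j then y k else 0)"
    have "S v = (\<Sum>k\<le>n. (if Suc k = j then y k else 0) + (if k = j then y k else 0)
        + (if k = Suc j then y k else 0))"
      unfolding Sy by (rule sum.cong) (auto simp: y0)
    also have "\<dots> = a + y j + c"
      using j(2) by (simp add: sum.distrib a_def c_def)
    finally have "S v = a + y j + c" .
    moreover have "a \<in> ?W (i - 1)"
    proof (cases j)
      case 0
      then show ?thesis
        by (simp add: a_def j(1))
    next
      case (Suc k)
      then show ?thesis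
        using y_in[of k] j by (simp add: a_def)
    qed
    moreover have "c \<in> ?W (i + 1)"
    proof (cases "j < n")
      case True
      then show ?thesis
        using y_in[of "Suc j"] j by (simp add: c_def add.commute)
    next
      case False
      then show ?thesis
        using j by (simp add: c_def)
    qed
    moreover have "y j \<in> ?W i"
      using y_in[of j] j by simp
    ultimately show "S v \<in> {a + b + c | a b c. a \<in> ?W (i - 1) \<and> b \<in> ?W i \<and> c \<in> ?W (i + 1)}"
      by blast
  qed
  then show ?thesis
    using bij unfolding tridiagonal_ordering_def by simp
qed

text \<open>
  The adjacency graph of the eigenvalues is connected: the eigenspaces for a union of components
  span a subspace that is invariant under both operators.
\<close>

lemma ex_tridiagonal_ordering:
  fixes scale :: "'a::field \<Rightarrow> 'v::ab_group_add \<Rightarrow> 'v"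
  assumes q: "q \<noteq> 0" "\<And>n::nat. n > 0 \<Longrightarrow> q ^ n \<noteq> 1"
    and fin: "finite_dim scale" and nontrivial: "(UNIV :: 'v set) \<noteq> {0}"
    and T: "Vector_Spaces.linear scale scale T"
    and S: "Vector_Spaces.linear scale scale S"
    and diag: "diagonalizable scale T"
    and DG: "dolan_grady scale q T S"
    and irred: "\<And>U. \<lbrakk>module.subspace scale U; T ` U \<subseteq> U; S ` U \<subseteq> U\<rbrakk> \<Longrightarrow> U = {0} \<or> U = UNIV"
  shows "\<exists>d W. tridiagonal_ordering scale T S d W"
proof -
  interpret vector_space scale
    using T by (simp add: Vector_Spaces.linear_def)
  interpret T: Vector_Spaces.linear scale scale T by (rule T)
  interpret S: Vector_Spaces.linear scale scale S by (rule S)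
  let ?E = "\<lambda>M. \<Union>c\<in>M. eigenspace scale T c"
  have finE: "finite (eigenvalues scale T)"
    by (rule finite_eigenvalues[OF T diag fin])
  have "eigenvalues scale T \<noteq> {}"
    using diag nontrivial by (auto simp: diagonalizable_def)
  moreover have "M = eigenvalues scale T"
    if M: "M \<subseteq> eigenvalues scale T" "M \<noteq> {}"
      and closed: "\<And>\<mu> \<nu>. \<lbrakk>\<mu> \<in> eigenvalues scale T; \<nu> \<in> M; q_adjacent q \<mu> \<nu>\<rbrakk> \<Longrightarrow> \<mu> \<in> M" for M
  proof -
    let ?U = "span (?E M)"
    have "S v \<in> ?U" if v: "v \<in> ?E M" for v
    proof -
      obtain \<nu> where \<nu>: "\<nu> \<in> M" "v \<in> eigenspace scale T \<nu>"
        using v by auto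
      obtain w where w: "\<And>c. c \<in> eigenvalues scale T \<Longrightarrow> w c \<in> eigenspace scale T c"
        and Sv: "S v = sum w (eigenvalues scale T)"
        using diagonalizable_decompose[OF T diag finE] by blast
      have "w \<mu> \<in> ?U" if "\<mu> \<in> eigenvalues scale T" for \<mu>
      proof (cases "w \<mu> = 0")
        case True
        then show ?thesis
          by (simp add: span_zero)
      next
        case False
        then have "\<mu> \<in> M"
          using dolan_grady_adjacent[OF q(1) T S DG \<nu>(2) finE w Sv that] closed[OF that \<nu>(1)] \<nu>(1)
          by auto
        then show ?thesis
          using w[OF that] by (auto intro: span_base)
      qed
      then show ?thesis
        unfolding Sv by (rule span_sum)
    qed
    then have SU: "S ` ?U \<subseteq> ?U"
      using S.span_image[of "?E M"] span_minimal[of "S ` ?E M" ?U] by auto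
    have "T v \<in> ?U" if v: "v \<in> ?E M" for v
    proof -
      obtain \<nu> where "T v = scale \<nu> v"
        using v by (auto simp: eigenspace_def)
      then show ?thesis
        using span_scale[OF span_base[OF v]] by simp
    qed
    then have TU: "T ` ?U \<subseteq> ?U"
      using T.span_image[of "?E M"] span_minimal[of "T ` ?E M" ?U] by auto
    obtain \<mu> v where "\<mu> \<in> M" "v \<noteq> 0" "v \<in> eigenspace scale T \<mu>"
      using M by (fastforce simp: eigenvalues_def eigenspace_def)
    then have "v \<in> ?U" "v \<noteq> 0"
      by (auto intro: span_base)
    then have "?U = UNIV"
      using irred[OF subspace_span TU SU] by blast
    then show ?thesis
      using M(1) finE by (intro eigenvalues_eq_of_span[OF T]) (auto intro: finite_subset)
  qed
  ultimately obtain n x where "inj_on x {..n}" "x ` {..n} = eigenvalues scale T"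
    "\<And>i j. \<lbrakk>i \<le> n; j \<le> n; i \<noteq> j; q_adjacent q (x i) (x j)\<rbrakk> \<Longrightarrow> i = Suc j \<or> j = Suc i"
    using q_adjacent_path[OF q finE, of thesis] by metis
  then show ?thesis
    using tridiagonal_orderingI[OF q(1) T S diag DG] by blast
qed

lemma tridiagonal_pair_of_dolan_grady:
  fixes scale :: "'a::field \<Rightarrow> 'v::ab_group_add \<Rightarrow> 'v"
  assumes "q \<noteq> 0" "\<And>n::nat. n > 0 \<Longrightarrow> q ^ n \<noteq> 1"
    and "finite_dim scale" and "(UNIV :: 'v set) \<noteq> {0}"
    and "Vector_Spaces.linear scale scale T" and "Vector_Spaces.linear scale scale S"
    and "diagonalizable scale T" and "diagonalizable scale S"
    and "dolan_grady scale q T S" and "dolan_grady scale q S T"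
    and irred: "\<And>U. \<lbrakk>module.subspace scale U; T ` U \<subseteq> U; S ` U \<subseteq> U\<rbrakk> \<Longrightarrow> U = {0} \<or> U = UNIV"
  shows "tridiagonal_pair scale T S"
proof -
  have "\<exists>d W. tridiagonal_ordering scale T S d W"
    by (rule ex_tridiagonal_ordering[OF assms(1-7) assms(9) irred])
  moreover have "\<exists>d W. tridiagonal_ordering scale S T d W"
    by (rule ex_tridiagonal_ordering[OF assms(1-4) assms(6) assms(5) assms(8) assms(10) irred])
  moreover have "\<not> (\<exists>U. module.subspace scale U \<and> U \<noteq> {0} \<and> U \<noteq> UNIV \<and> T ` U \<subseteq> U \<and> S ` U \<subseteq> U)"
    using irred by blast
  ultimately show ?thesis
    using assms(3-8) by (simp add: tridiagonal_pair_def)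
qed

section \<open>Isomorphisms of tridiagonal pairs\<close>

text \<open>
  The hypotheses on eigenspaces and eigenvalues are those consequences of
  \<open>\<gamma> \<circ> T = T' \<circ> \<gamma>\<close> that matter for orderings; they are derived from it below.
\<close>

lemma tridiagonal_ordering_transport:
  assumes \<gamma>: "Vector_Spaces.linear scale scale' \<gamma>" "bij \<gamma>"
    and ES: "\<And>c. eigenspace scale' T' c = \<gamma> ` eigenspace scale T c"
    and eig: "eigenvalues scale' T' = eigenvalues scale T"
    and S: "\<gamma> \<circ> S = S' \<circ> \<gamma>"
    and W: "tridiagonal_ordering scale T S d W"
  shows "tridiagonal_ordering scale' T' S' d (\<lambda>i. \<gamma> ` W i)"
proof -
  interpret \<gamma>: Vector_Spaces.linear scale scale' \<gamma> by (rule \<gamma>(1))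
  have "bij_betw ((`) \<gamma> \<circ> W) {0..int d} ((`) \<gamma> ` eigenspace scale T ` eigenvalues scale T)"
  proof (rule bij_betw_trans)
    show "bij_betw W {0..int d} (eigenspace scale T ` eigenvalues scale T)"
      using W by (simp add: tridiagonal_ordering_def)
    show "bij_betw ((`) \<gamma>) (eigenspace scale T ` eigenvalues scale T)
        ((`) \<gamma> ` eigenspace scale T ` eigenvalues scale T)"
      using \<gamma>(2) by (auto simp: bij_betw_def inj_on_def inj_image_eq_iff)
  qed
  then have "bij_betw (\<lambda>i. \<gamma> ` W i) {0..int d} (eigenspace scale' T' ` eigenvalues scale' T')"
    by (simp add: ES eig image_image comp_def)
  moreover have "S' ` \<gamma> ` W i
      \<subseteq> {x + y + z | x y z. x \<in> \<gamma> ` W (i - 1) \<and> y \<in> \<gamma> ` W i \<and> z \<in> \<gamma> ` W (i + 1)}"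
    if i: "i \<in> {0..int d}" for i
  proof (clarsimp)
    fix v assume "v \<in> W i"
    then have "S v \<in> {x + y + z | x y z. x \<in> W (i - 1) \<and> y \<in> W i \<and> z \<in> W (i + 1)}"
      using W i unfolding tridiagonal_ordering_def by blast
    then obtain x y z where xyz: "S v = x + y + z" "x \<in> W (i - 1)" "y \<in> W i" "z \<in> W (i + 1)"
      by blast
    have "S' (\<gamma> v) = \<gamma> x + \<gamma> y + \<gamma> z"
      using fun_cong[OF S, of v] xyz(1) by (simp add: \<gamma>.add)
    then show "\<exists>x y z. S' (\<gamma> v) = x + y + z \<and> x \<in> \<gamma> ` W (i - 1) \<and> y \<in> \<gamma> ` W i \<and> z \<in> \<gamma> ` W (i + 1)"
      using xyz by blast
  qed
  ultimately show ?thesis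
    using W by (simp add: tridiagonal_ordering_def \<gamma>.zero)
qed

context
  fixes scale :: "'a::field \<Rightarrow> 'v::ab_group_add \<Rightarrow> 'v"
    and scale' :: "'a \<Rightarrow> 'w::ab_group_add \<Rightarrow> 'w"
    and \<gamma> :: "'v \<Rightarrow> 'w"
  assumes \<gamma>: "Vector_Spaces.linear scale scale' \<gamma>" "bij \<gamma>"
begin

interpretation \<gamma>: Vector_Spaces.linear scale scale' \<gamma>
  by (rule \<gamma>(1))

interpretation vector_space_pair scale scale'
  by unfold_locales

lemma eigenspace_transport:
  assumes "\<gamma> \<circ> T = T' \<circ> \<gamma>"
  shows "eigenspace scale' T' c = \<gamma> ` eigenspace scale T c"
proof -
  have "\<gamma> v \<in> eigenspace scale' T' c \<longleftrightarrow> v \<in> eigenspace scale T c" for v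
  proof -
    have "T' (\<gamma> v) = \<gamma> (T v)"
      using fun_cong[OF assms, of v] by simp
    then show ?thesis
      using bij_is_inj[OF \<gamma>(2)] by (simp add: eigenspace_def inj_eq flip: \<gamma>.scale)
  qed
  then have "\<gamma> -` eigenspace scale' T' c = eigenspace scale T c"
    by auto
  then show ?thesis
    using bij_is_surj[OF \<gamma>(2)] by (metis surj_image_vimage_eq)
qed

lemma eigenvalues_transport:
  assumes "\<gamma> \<circ> T = T' \<circ> \<gamma>"
  shows "eigenvalues scale' T' = eigenvalues scale T"
proof -
  have *: "\<gamma> v = 0 \<longleftrightarrow> v = 0" for v
    using inj_eq[OF bij_is_inj[OF \<gamma>(2)], of v 0] by (simp add: \<gamma>.zero)
  have "c \<in> eigenvalues scale' T' \<longleftrightarrow> c \<in> eigenvalues scale T" for c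
  proof -
    have "c \<in> eigenvalues scale' T' \<longleftrightarrow> (\<exists>v \<in> eigenspace scale' T' c. v \<noteq> 0)"
      by (auto simp: eigenvalues_def eigenspace_def)
    also have "\<dots> \<longleftrightarrow> (\<exists>v \<in> eigenspace scale T c. v \<noteq> 0)"
      by (simp add: eigenspace_transport[OF assms] *)
    also have "\<dots> \<longleftrightarrow> c \<in> eigenvalues scale T"
      by (auto simp: eigenvalues_def eigenspace_def)
    finally show ?thesis .
  qed
  then show ?thesis
    by blast
qed

lemma diagonalizable_transport:
  assumes "\<gamma> \<circ> T = T' \<circ> \<gamma>" and "diagonalizable scale T"
  shows "diagonalizable scale' T'"
proof -
  have "(\<Union>c\<in>eigenvalues scale' T'. eigenspace scale' T' c)
      = \<gamma> ` (\<Union>c\<in>eigenvalues scale T. eigenspace scale T c)"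
    by (simp add: eigenvalues_transport[OF assms(1)] eigenspace_transport[OF assms(1)] image_UN)
  then show ?thesis
    using assms(2) \<gamma>(2) by (simp add: diagonalizable_def \<gamma>.span_image bij_is_surj)
qed

lemma finite_dim_transport:
  assumes "finite_dim scale"
  shows "finite_dim scale'"
proof -
  obtain B where "finite_dimensional_vector_space scale B"
    using assms by (auto simp: finite_dim_def)
  then interpret B: finite_dimensional_vector_space scale B .
  have "finite_dimensional_vector_space scale' (\<gamma> ` B)"
  proof unfold_locales
    show "finite (\<gamma> ` B)"
      by (simp add: B.finite_Basis)
    show "\<gamma>.vs2.independent (\<gamma> ` B)"
      using inj_on_subset[OF bij_is_inj[OF \<gamma>(2)] subset_UNIV]
      by (rule linear_independent_injective_image[OF \<gamma>(1) B.independent_Basis])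
    show "\<gamma>.vs2.span (\<gamma> ` B) = UNIV"
      using \<gamma>(2) by (simp add: \<gamma>.span_image B.span_Basis bij_is_surj)
  qed
  then show ?thesis
    by (auto simp: finite_dim_def)
qed

lemma tridiagonal_pair_transport:
  assumes TD: "tridiagonal_pair scale T S"
    and T': "Vector_Spaces.linear scale' scale' T'"
    and S': "Vector_Spaces.linear scale' scale' S'"
    and T: "\<gamma> \<circ> T = T' \<circ> \<gamma>" and S: "\<gamma> \<circ> S = S' \<circ> \<gamma>"
  shows "tridiagonal_pair scale' T' S'"
proof -
  obtain d W where W: "tridiagonal_ordering scale T S d W"
    using TD by (auto simp: tridiagonal_pair_def)
  obtain d' Ws where Ws: "tridiagonal_ordering scale S T d' Ws"
    using TD by (auto simp: tridiagonal_pair_def)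
  have "U = {0} \<or> U = UNIV"
    if U: "\<gamma>.vs2.subspace U" "T' ` U \<subseteq> U" "S' ` U \<subseteq> U" for U
  proof -
    have "\<gamma>.vs1.subspace (\<gamma> -` U)"
      using U(1) by (rule \<gamma>.subspace_vimage)
    moreover have "T ` (\<gamma> -` U) \<subseteq> \<gamma> -` U" "S ` (\<gamma> -` U) \<subseteq> \<gamma> -` U"
      using U(2,3) T S by (auto simp: fun_eq_iff image_subset_iff)
    ultimately have "\<gamma> -` U = {0} \<or> \<gamma> -` U = UNIV"
      using TD unfolding tridiagonal_pair_def by blast
    moreover have "U = \<gamma> ` (\<gamma> -` U)"
      using bij_is_surj[OF \<gamma>(2)] by (simp add: surj_image_vimage_eq)
    ultimately show ?thesis
      using bij_is_surj[OF \<gamma>(2)] by (metis \<gamma>.zero image_empty image_insert)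
  qed
  then have irred: "\<not> (\<exists>U. \<gamma>.vs2.subspace U \<and> U \<noteq> {0} \<and> U \<noteq> UNIV \<and> T' ` U \<subseteq> U \<and> S' ` U \<subseteq> U)"
    by blast
  have "\<exists>d W'. tridiagonal_ordering scale' T' S' d W'"
    by (intro exI) (rule tridiagonal_ordering_transport[OF \<gamma> eigenspace_transport[OF T] eigenvalues_transport[OF T] S W])
  moreover have "\<exists>d W'. tridiagonal_ordering scale' S' T' d W'"
    by (intro exI) (rule tridiagonal_ordering_transport[OF \<gamma> eigenspace_transport[OF S] eigenvalues_transport[OF S] T Ws])
  moreover note irred
  moreover have "(UNIV :: 'w set) \<noteq> {0}"
  proof
    assume "(UNIV :: 'w set) = {0}"
    then have "\<gamma> v = \<gamma> 0" for v
      by (metis UNIV_I singletonD)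
    then have "(UNIV :: 'v set) = {0}"
      using \<gamma>(2) by (auto simp: bij_def inj_def)
    then show False
      using TD by (simp add: tridiagonal_pair_def)
  qed
  moreover have "finite_dim scale'" "diagonalizable scale' T'" "diagonalizable scale' S'"
    using TD finite_dim_transport diagonalizable_transport[OF T] diagonalizable_transport[OF S]
    by (simp_all add: tridiagonal_pair_def)
  ultimately show ?thesis
    using T' S' by (simp add: tridiagonal_pair_def)
qed

lemma linear_inv: "Vector_Spaces.linear scale' scale (inv_into UNIV \<gamma>)"
proof unfold_locales
  fix x y c
  obtain v w where "x = \<gamma> v" "y = \<gamma> w"
    using \<gamma>(2) by (metis bij_pointE)
  then show "inv_into UNIV \<gamma> (x + y) = inv_into UNIV \<gamma> x + inv_into UNIV \<gamma> y" "inv_into UNIV \<gamma> (scale' c x) = scale c (inv_into UNIV \<gamma> x)"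
    using \<gamma>(2) by (simp_all add: bij_is_inj inv_f_f flip: \<gamma>.add \<gamma>.scale)
qed

end

lemma comp_inv_intertwines:
  assumes "bij \<gamma>" and "\<gamma> \<circ> T = S \<circ> \<gamma>"
  shows "inv_into UNIV \<gamma> \<circ> S = T \<circ> inv_into UNIV \<gamma>"
proof
  fix x
  obtain v where x: "x = \<gamma> v"
    using assms(1) by (metis bij_pointE)
  have "S x = \<gamma> (T v)"
    using fun_cong[OF assms(2), of v] by (simp add: x)
  then show "(inv_into UNIV \<gamma> \<circ> S) x = (T \<circ> inv_into UNIV \<gamma>) x"
    using bij_is_inj[OF assms(1)] by (simp add: x)
qed

lemma td_isomorphism_inv:
  assumes "td_isomorphism scale T Ts scale' S Ss \<gamma>"
  shows "td_isomorphism scale' S Ss scale T Ts (inv_into UNIV \<gamma>)"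
  using assms unfolding td_isomorphism_def
  by (auto simp: linear_inv bij_imp_bij_inv comp_inv_intertwines)

lemma td_isomorphism_comp:
  assumes "td_isomorphism scale T Ts scale' S Ss \<gamma>"
    and "td_isomorphism scale' S Ss scale'' R Rs \<delta>"
  shows "td_isomorphism scale T Ts scale'' R Rs (\<delta> \<circ> \<gamma>)"
  using assms unfolding td_isomorphism_def
  by (auto simp: bij_comp fun_eq_iff intro: Vector_Spaces.linear_compose)

section \<open>The map H\<close>

text \<open>
  In terms of \<open>z\<close> with \<open>\<theta> = z + z\<inverse>\<close> the quadratic equation factors completely: the
  neighbours of \<open>y + y\<inverse>\<close> come from \<open>z = q\<^sup>2y\<close> and \<open>z = q\<^sup>-\<^sup>2y\<close>, up to replacing \<open>z\<close> by its
  inverse.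
\<close>

lemma q_adjacent_iff:
  fixes q z y :: "'a::field"
  assumes "q \<noteq> 0" "z \<noteq> 0" "y \<noteq> 0"
  shows "q_adjacent q (z + inverse z) (y + inverse y) \<longleftrightarrow>
    z = q\<^sup>2 * y \<or> y = q\<^sup>2 * z \<or> q\<^sup>2 * (z * y) = 1 \<or> z * y = q\<^sup>2"
proof -
  have "(q\<^sup>2 * z\<^sup>2 * y\<^sup>2) * q\<^sup>2 * ((z + inverse z)\<^sup>2 - (q\<^sup>2 + inverse (q\<^sup>2)) * (z + inverse z) * (y + inverse y)
      + (y + inverse y)\<^sup>2 + (q\<^sup>2 - inverse (q\<^sup>2))\<^sup>2)
    = (z - q\<^sup>2 * y) * (q\<^sup>2 * z - y) * (q\<^sup>2 * (z * y) - 1) * (z * y - q\<^sup>2)"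
    using assms by (simp add: field_simps power2_eq_square)
  then have "q_adjacent q (z + inverse z) (y + inverse y) \<longleftrightarrow>
    (z - q\<^sup>2 * y) * (q\<^sup>2 * z - y) * (q\<^sup>2 * (z * y) - 1) * (z * y - q\<^sup>2) = 0"
    using assms unfolding q_adjacent_def by (metis mult_eq_0_iff power_eq_0_iff)
  then show ?thesis
    by auto
qed

text \<open>
  The case of interest is \<open>z\<^sub>i = a q\<^sup>d\<^sup>-\<^sup>2\<^sup>i\<close>. Three of the cases of \<open>q_adjacent_iff\<close>
  compare \<open>z\<close> at two indices after one of \<open>i\<close>, \<open>j\<close> is moved by one step; distinctness of the
  eigenvalues settles the comparison. Moving \<open>j\<close> down or \<open>i\<close> up keeps the indices between
  \<open>0\<close> and \<open>d\<close> because \<open>i < j\<close>. With \<open>i < j\<close>, the case \<open>z\<^sub>j = q\<^sup>2z\<^sub>i\<close> makes \<open>q\<close> a root of unity.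
\<close>

lemma q_adjacent_spectrum:
  fixes z \<theta> :: "nat \<Rightarrow> 'a::field"
  assumes q: "q \<noteq> 0" "\<And>n::nat. n > 0 \<Longrightarrow> q ^ n \<noteq> 1"
    and z: "\<And>i. z i \<noteq> 0" "\<And>i. z i = q\<^sup>2 * z (Suc i)"
    and \<theta>: "\<And>i. i \<le> d \<Longrightarrow> \<theta> i = z i + inverse (z i)"
    and inj: "inj_on \<theta> {..d}"
    and ij: "i \<le> d" "j \<le> d" "i \<noteq> j" and adj: "q_adjacent q (\<theta> i) (\<theta> j)"
  shows "i = Suc j \<or> j = Suc i"
proof -
  have *: "j = Suc i" if lt: "i < j" and j: "j \<le> d" and adj: "q_adjacent q (\<theta> i) (\<theta> j)" for i j
  proof -
    obtain k where k: "j = Suc k"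
      using lt by (cases j) auto
    have eqD: "m = n" if "m \<le> d" "n \<le> d" "z m = z n \<or> z m * z n = 1" for m n
    proof -
      have "\<theta> m = \<theta> n"
        using that(3) z(1) by (auto simp: \<theta> that(1,2) inverse_unique mult.commute add.commute)
      then show ?thesis
        using inj that(1,2) by (auto simp: inj_on_def)
    qed
    have zk: "z k = q\<^sup>2 * z j" and zi: "z i = q\<^sup>2 * z (Suc i)"
      unfolding k by (rule z(2))+
    consider "z i = q\<^sup>2 * z j" | "z j = q\<^sup>2 * z i" | "q\<^sup>2 * (z i * z j) = 1" | "z i * z j = q\<^sup>2"
      using adj lt j q(1) z(1) by (auto simp: \<theta> q_adjacent_iff)
    then show ?thesis
    proof cases
      case 1
      then show ?thesis
        using eqD[of i k] zk k lt j by auto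
    next
      case 2
      have pow: "z i = q ^ (2 * n) * z (i + n)" for n
      proof (induction n)
        case (Suc n)
        then show ?case
          using z(2)[of "i + n"] by (simp add: power2_eq_square mult.assoc)
      qed simp
      have "z i = q ^ (2 * (j - i)) * (q\<^sup>2 * z i)"
        using pow[of "j - i"] 2 lt by simp
      then have "q ^ (2 * (j - i)) * q\<^sup>2 = 1"
        using z(1)[of i] by (simp flip: mult.assoc)
      then have "q ^ (2 * (j - i) + 2) = 1"
        by (simp only: power_add)
      moreover have "q ^ (2 * (j - i) + 2) \<noteq> 1"
        by (rule q(2)) simp
      ultimately show ?thesis
        by contradiction
    next
      case 3
      then show ?thesis
        using eqD[of i k] zk k lt j by (simp add: mult.left_commute)
    next
      case 4
      then have "z (Suc i) * z j = 1"
        using zi q(1) by simp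
      then show ?thesis
        using eqD[of "Suc i" j] lt j by simp
    qed
  qed
  show ?thesis
    using *[of i j] *[of j i] ij adj q_adjacent_sym[of q "\<theta> i"] by (metis linorder_neqE_nat)
qed

lemma t_pair_same: "t_pair q \<theta> i i = 1"
  by (simp add: t_pair_def)

text \<open>
  Both factors of \<open>t_pair\<close> split off \<open>q - q\<inverse>\<close> and \<open>q\<^sup>2 - q\<^sup>-\<^sup>2\<close>, which cancel the
  denominators; a monomial in \<open>y = z\<^sub>i\<^sub>+\<^sub>1\<close> is left. In particular the two values are nonzero and
  inverse to each other.
\<close>

lemma t_pair_Suc:
  fixes z \<theta> :: "nat \<Rightarrow> 'a::field"
  assumes q: "q \<noteq> 0" "\<And>n::nat. n > 0 \<Longrightarrow> q ^ n \<noteq> 1"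
    and z: "z i \<noteq> 0" "z (Suc i) \<noteq> 0" "z i = q\<^sup>2 * z (Suc i)"
    and \<theta>: "\<theta> i = z i + inverse (z i)" "\<theta> (Suc i) = z (Suc i) + inverse (z (Suc i))"
  shows "t_pair q \<theta> i (Suc i) = (q * z (Suc i))\<^sup>2"
    and "t_pair q \<theta> (Suc i) i = inverse ((q * z (Suc i))\<^sup>2)"
proof -
  define y where "y = z (Suc i)"
  have y: "y \<noteq> 0" "\<theta> i = q\<^sup>2 * y + inverse (q\<^sup>2 * y)" "\<theta> (Suc i) = y + inverse y"
    using z \<theta> by (simp_all add: y_def)
  define r where "r = q - inverse q"
  define s where "s = q\<^sup>2 - inverse (q\<^sup>2)"
  have "q * r = q ^ 2 - 1" "q\<^sup>2 * s = q ^ 4 - 1"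
    using q(1) by (simp_all add: r_def s_def field_simps power2_eq_square power4_eq_xxxx)
  then have rs: "r \<noteq> 0" "s \<noteq> 0"
    using q(2)[of 2] q(2)[of 4] by auto
  have diff: "\<theta> i - \<theta> (Suc i) = r * (q * y - inverse (q * y))"
    unfolding y r_def using q(1) y(1) by (simp add: field_simps power2_eq_square)
  have down: "q * \<theta> i - inverse q * \<theta> (Suc i) = s * (q * y)"
    unfolding y s_def using q(1) y(1) by (simp add: field_simps power2_eq_square)
  have up: "q * \<theta> (Suc i) - inverse q * \<theta> i = s * inverse (q * y)"
    unfolding y s_def using q(1) y(1) by (simp add: field_simps power2_eq_square)
  have "t_pair q \<theta> i (Suc i) = 1 + (q * y - inverse (q * y)) * (q * y)"
    unfolding t_pair_def diff down using rs by (simp flip: r_def s_def)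
  then show "t_pair q \<theta> i (Suc i) = (q * z (Suc i))\<^sup>2"
    using q(1) y(1) by (simp add: field_simps power2_eq_square flip: y_def)
  have "\<theta> (Suc i) - \<theta> i = - (r * (q * y - inverse (q * y)))"
    using diff by (metis minus_diff_eq)
  then have "t_pair q \<theta> (Suc i) i = 1 - (q * y - inverse (q * y)) * inverse (q * y)"
    unfolding t_pair_def up using rs by (simp flip: r_def s_def) (simp add: algebra_simps)
  then show "t_pair q \<theta> (Suc i) i = inverse ((q * z (Suc i))\<^sup>2)"
    using q(1) y(1) by (simp add: field_simps power2_eq_square flip: y_def)
qed

context
  fixes scale :: "'a::field \<Rightarrow> 'v::ab_group_add \<Rightarrow> 'v"
    and A :: "'v \<Rightarrow> 'v" and q :: 'a and d :: nat and \<theta> :: "nat \<Rightarrow> 'a" and E :: "nat \<Rightarrow> 'v \<Rightarrow> 'v"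
  assumes A: "Vector_Spaces.linear scale scale A"
    and diag: "diagonalizable scale A"
    and image: "\<theta> ` {..d} = eigenvalues scale A"
    and E: "\<And>i. i \<le> d \<Longrightarrow> projection_along scale (eigenspace scale A (\<theta> i))
        (module.span scale (\<Union>j \<in> {..d} - {i}. eigenspace scale A (\<theta> j))) (E i)"
begin

interpretation vector_space scale
  using A by (simp add: Vector_Spaces.linear_def)

interpretation vector_space_pair scale scale
  by unfold_locales

interpretation A: Vector_Spaces.linear scale scale A
  by (rule A)

lemma linear_eq_on_eigenspaces:
  assumes "Vector_Spaces.linear scale scale f" "Vector_Spaces.linear scale scale g"
    and eq: "\<And>j v. \<lbrakk>j \<le> d; v \<in> eigenspace scale A (\<theta> j)\<rbrakk> \<Longrightarrow> f v = g v"
  shows "f = g"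
proof
  fix v
  have "v \<in> span (\<Union>c\<in>\<theta> ` {..d}. eigenspace scale A c)"
    using diag by (simp only: image diagonalizable_def UNIV_I)
  then show "f v = g v"
    by (rule linear_eq_on[OF assms(1,2)]) (use eq in auto)
qed

lemma linear_projection: "i \<le> d \<Longrightarrow> Vector_Spaces.linear scale scale (E i)"
  using E by (simp add: projection_along_def)

lemma linear_projection_sum:
  "Vector_Spaces.linear scale scale (\<lambda>v. \<Sum>i\<le>d. scale (c i) (E i v))"
  by (intro linear_compose_sum ballI linear_compose_scale_right linear_projection) simp

lemma projection_sum_eigenvector:
  assumes j: "j \<le> d" and v: "v \<in> eigenspace scale A (\<theta> j)"
  shows "(\<Sum>i\<le>d. scale (c i) (E i v)) = scale (c j) v"
proof -
  have "E i v = (if i = j then v else 0)" if i: "i \<le> d" for i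
  proof (cases "i = j")
    case True
    then show ?thesis
      using E[OF i] v by (simp add: projection_along_def)
  next
    case False
    then have "v \<in> span (\<Union>j \<in> {..d} - {i}. eigenspace scale A (\<theta> j))"
      using j v by (intro span_base) auto
    then show ?thesis
      using E[OF i] False by (simp add: projection_along_def)
  qed
  then have "(\<Sum>i\<le>d. scale (c i) (E i v)) = (\<Sum>i\<le>d. if i = j then scale (c i) v else 0)"
    by (intro sum.cong) auto
  then show ?thesis
    using j by simp
qed

lemma linear_H_map: "Vector_Spaces.linear scale scale (H_map scale q d \<theta> E)"
  unfolding H_map_def by (rule linear_projection_sum)

lemma H_map_eigenvector:
  assumes "j \<le> d" and "v \<in> eigenspace scale A (\<theta> j)"
  shows "H_map scale q d \<theta> E v = scale (t_coeff q \<theta> j) v"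
  unfolding H_map_def by (rule projection_sum_eigenvector[OF assms])

lemma H_map_commutes: "H_map scale q d \<theta> E \<circ> A = A \<circ> H_map scale q d \<theta> E"
proof (rule linear_eq_on_eigenspaces)
  show "Vector_Spaces.linear scale scale (H_map scale q d \<theta> E \<circ> A)"
    "Vector_Spaces.linear scale scale (A \<circ> H_map scale q d \<theta> E)"
    by (intro Vector_Spaces.linear_compose[OF A linear_H_map] Vector_Spaces.linear_compose[OF linear_H_map A])+
  fix j v assume j: "j \<le> d" and v: "v \<in> eigenspace scale A (\<theta> j)"
  have "A v = scale (\<theta> j) v"
    using v by (simp add: eigenspace_def)
  moreover have "scale (\<theta> j) v \<in> eigenspace scale A (\<theta> j)"
    by (rule subspace_scale[OF subspace_eigenspace[OF A] v])
  ultimately show "(H_map scale q d \<theta> E \<circ> A) v = (A \<circ> H_map scale q d \<theta> E) v"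
    by (simp add: H_map_eigenvector[OF j] v A.scale mult.commute)
qed

lemma bij_H_map:
  assumes t: "\<And>i. i \<le> d \<Longrightarrow> t_coeff q \<theta> i \<noteq> 0"
  shows "bij (H_map scale q d \<theta> E)"
proof -
  let ?H = "H_map scale q d \<theta> E"
  define G where "G v = (\<Sum>i\<le>d. scale (inverse (t_coeff q \<theta> i)) (E i v))" for v
  have G: "Vector_Spaces.linear scale scale G"
    unfolding G_def by (rule linear_projection_sum)
  have Gv: "G v = scale (inverse (t_coeff q \<theta> j)) v"
    if "j \<le> d" "v \<in> eigenspace scale A (\<theta> j)" for j v
    unfolding G_def by (rule projection_sum_eigenvector[OF that])
  interpret G: Vector_Spaces.linear scale scale G by (rule G)
  interpret H: Vector_Spaces.linear scale scale ?H by (rule linear_H_map)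
  have "G \<circ> ?H = id"
  proof (rule linear_eq_on_eigenspaces)
    fix j v assume j: "j \<le> d" and v: "v \<in> eigenspace scale A (\<theta> j)"
    show "(G \<circ> ?H) v = id v"
      using t[OF j] by (simp add: H_map_eigenvector[OF j v] G.scale Gv[OF j v])
  qed (intro Vector_Spaces.linear_compose[OF linear_H_map G] linear_id)+
  moreover have "?H \<circ> G = id"
  proof (rule linear_eq_on_eigenspaces)
    fix j v assume j: "j \<le> d" and v: "v \<in> eigenspace scale A (\<theta> j)"
    show "(?H \<circ> G) v = id v"
      using t[OF j] by (simp add: H_map_eigenvector[OF j v] H.scale Gv[OF j v])
  qed (intro Vector_Spaces.linear_compose[OF G linear_H_map] linear_id)+
  ultimately show ?thesis
    by (rule o_bij)
qed

text \<open>
  On an eigenvector for \<open>\<theta>\<^sub>j\<close> the component of \<open>B v\<close> for \<open>\<theta>\<^sub>i\<close> is \<open>t\<^sub>i\<^sub>j\<close> times that of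
  \<open>As v\<close>, so the claim is \<open>t\<^sub>i\<^sub>j t\<^sub>i = t\<^sub>j\<close> whenever that component is nonzero.
\<close>

lemma H_map_intertwines:
  assumes q: "q \<noteq> 0" "\<And>n::nat. n > 0 \<Longrightarrow> q ^ n \<noteq> 1"
    and inj: "inj_on \<theta> {..d}"
    and z: "\<And>i. z i \<noteq> 0" "\<And>i. z i = q\<^sup>2 * z (Suc i)"
    and \<theta>: "\<And>i. i \<le> d \<Longrightarrow> \<theta> i = z i + inverse (z i)"
    and As: "Vector_Spaces.linear scale scale As"
    and B: "Vector_Spaces.linear scale scale B"
    and DG: "dolan_grady scale q A As"
    and B_eq: "\<And>v. B v = As v + scale (inverse ((q - inverse q) * (q\<^sup>2 - inverse (q\<^sup>2))))
        (op_bracket scale 1 1 A (op_bracket scale q (inverse q) A As) v)"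
  shows "H_map scale q d \<theta> E \<circ> B = As \<circ> H_map scale q d \<theta> E"
proof (rule linear_eq_on_eigenspaces)
  let ?H = "H_map scale q d \<theta> E" and ?eig = "eigenvalues scale A"
  interpret As: Vector_Spaces.linear scale scale As by (rule As)
  interpret H: Vector_Spaces.linear scale scale ?H by (rule linear_H_map)
  show "Vector_Spaces.linear scale scale (?H \<circ> B)" "Vector_Spaces.linear scale scale (As \<circ> ?H)"
    by (intro Vector_Spaces.linear_compose[OF B linear_H_map] Vector_Spaces.linear_compose[OF linear_H_map As])+
  fix j v assume j: "j \<le> d" and v: "v \<in> eigenspace scale A (\<theta> j)"
  have fin: "finite ?eig"
    unfolding image[symmetric] by simp
  obtain w where w: "\<And>c. c \<in> ?eig \<Longrightarrow> w c \<in> eigenspace scale A c" and Asv: "As v = sum w ?eig"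
    using diagonalizable_decompose[OF A diag fin] by blast
  define k where "k = inverse ((q - inverse q) * (q\<^sup>2 - inverse (q\<^sup>2)))"
  have reindex: "sum g ?eig = (\<Sum>i\<le>d. g (\<theta> i))" for g :: "'a \<Rightarrow> 'v"
    unfolding image[symmetric] using inj by (simp add: sum.reindex)
  have t: "t_pair q \<theta> i j = 1 + k * ((\<theta> i - \<theta> j) * (q * \<theta> i - inverse q * \<theta> j))" for i
    by (simp add: t_pair_def k_def divide_inverse mult_ac)
  have w1: "scale (q * c - inverse q * \<theta> j) (w c) \<in> eigenspace scale A c" if "c \<in> ?eig" for c
    using subspace_scale[OF subspace_eigenspace[OF A] w[OF that]] .
  have bracket1: "op_bracket scale q (inverse q) A As v = (\<Sum>c\<in>?eig. scale (q * c - inverse q * \<theta> j) (w c))"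
    by (rule op_bracket_eigenvector[OF A As v w Asv])
  have "op_bracket scale 1 1 A (op_bracket scale q (inverse q) A As) v
      = (\<Sum>c\<in>?eig. scale (1 * c - 1 * \<theta> j) (scale (q * c - inverse q * \<theta> j) (w c)))"
    by (rule op_bracket_eigenvector[OF A linear_op_bracket[OF A As] v w1 bracket1])
  then have "B v = (\<Sum>i\<le>d. w (\<theta> i))
      + scale k (\<Sum>i\<le>d. scale (\<theta> i - \<theta> j) (scale (q * \<theta> i - inverse q * \<theta> j) (w (\<theta> i))))"
    unfolding B_eq Asv reindex by (simp add: k_def)
  also have "\<dots> = (\<Sum>i\<le>d. scale (t_pair q \<theta> i j) (w (\<theta> i)))"
    by (simp add: t scale_sum_right scale_left_distrib flip: sum.distrib)
  finally have Bv: "B v = (\<Sum>i\<le>d. scale (t_pair q \<theta> i j) (w (\<theta> i)))" .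
  have Hw: "?H (w (\<theta> i)) = scale (t_coeff q \<theta> i) (w (\<theta> i))" if "i \<le> d" for i
    by (rule H_map_eigenvector[OF that w]) (use image that in auto)
  have "?H (B v) = (\<Sum>i\<le>d. scale (t_pair q \<theta> i j * t_coeff q \<theta> i) (w (\<theta> i)))"
    by (simp add: Bv H.sum H.scale Hw)
  also have "\<dots> = (\<Sum>i\<le>d. scale (t_coeff q \<theta> j) (w (\<theta> i)))"
  proof (rule sum.cong[OF refl])
    fix i assume "i \<in> {..d}"
    then have i: "i \<le> d" "\<theta> i \<in> ?eig"
      using image by auto
    show "scale (t_pair q \<theta> i j * t_coeff q \<theta> i) (w (\<theta> i)) = scale (t_coeff q \<theta> j) (w (\<theta> i))"
    proof (cases "w (\<theta> i) = 0")
      case False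
      have "\<theta> i = \<theta> j \<or> q_adjacent q (\<theta> i) (\<theta> j)"
        by (rule dolan_grady_adjacent[OF q(1) A As DG v fin w Asv i(2) False])
      then consider "i = j" | "j = Suc i" | "i = Suc j"
        using q_adjacent_spectrum[OF q z \<theta> inj i(1) j] inj i(1) j by (auto simp: inj_on_def)
      then have "t_pair q \<theta> i j * t_coeff q \<theta> i = t_coeff q \<theta> j"
      proof cases
        case 1
        then show ?thesis
          by (simp add: t_pair_same)
      next
        case 2
        then show ?thesis
          by (simp add: t_coeff_def mult.commute)
      next
        case 3
        have "t_pair q \<theta> (Suc j) j * t_pair q \<theta> j (Suc j) = 1"
          using t_pair_Suc[of q z j \<theta>, OF q z(1) z(1) z(2) \<theta> \<theta>] i(1) 3 q(1) z(1)[of "Suc j"] by simp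
        then show ?thesis
          using 3 by (simp add: t_coeff_def mult.left_commute)
      qed
      then show ?thesis
        by simp
    qed simp
  qed
  also have "\<dots> = As (?H v)"
    by (simp add: H_map_eigenvector[OF j v] As.scale Asv reindex scale_sum_right)
  finally show "(?H \<circ> B) v = (As \<circ> ?H) v"
    by simp
qed

end

theorem proposition3p11:
  fixes q a :: "'a::field"
    and scale :: "'a \<Rightarrow> 'v::ab_group_add \<Rightarrow> 'v"
    and \<rho> :: "(gen_word \<Rightarrow>\<^sub>0 'a) set \<Rightarrow> 'v \<Rightarrow> 'v"
    and L :: "(gen_word \<Rightarrow>\<^sub>0 'a) set \<Rightarrow> (gen_word \<Rightarrow>\<^sub>0 'a) set"
    and d :: nat
    and \<theta> :: "nat \<Rightarrow> 'a"
    and E :: "nat \<Rightarrow> 'v \<Rightarrow> 'v"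
  defines "A \<equiv> \<rho> (onsA q)"
    and "As \<equiv> \<rho> (onsAs q)"
    and "LAs \<equiv> \<rho> (L (onsAs q))"
    and "LinvAs \<equiv> \<rho> (inv_into (carrier (q_onsager q)) L (onsAs q))"
    and "H \<equiv> H_map scale q d \<theta> E"
  assumes q_nonzero: "q \<noteq> 0"
    and q_not_root_of_unity: "\<And>n::nat. n > 0 \<Longrightarrow> q ^ n \<noteq> 1"
    and V_irreducible: "irreducible_alg_module (q_onsager q) scale \<rho>"
    and V_finite_dim: "finite_dim scale"
    and V_dim: "vector_space.dim scale (UNIV :: 'v set) \<ge> 2"
    and A_diagonalizable: "diagonalizable scale A"
    and As_diagonalizable: "diagonalizable scale As"
    and d_pos: "d \<ge> 1"
    and \<theta>_distinct: "inj_on \<theta> {..d}"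
    and \<theta>_eigenvalues: "\<theta> ` {..d} = eigenvalues scale A"
    and a_nonzero: "a \<noteq> 0"
    and \<theta>_formula: "\<And>i. i \<le> d \<Longrightarrow>
      \<theta> i = a * q powi (int d - 2 * int i) + inverse a * q powi (2 * int i - int d)"
    and E_projection: "\<And>i. i \<le> d \<Longrightarrow>
      projection_along scale (eigenspace scale A (\<theta> i))
        (module.span scale (\<Union>j \<in> {..d} - {i}. eigenspace scale A (\<theta> j))) (E i)"
    and L_lusztig: "lusztig_automorphism q L"
  shows "(tridiagonal_pair scale A As \<and>
      tridiagonal_pair scale A LAs \<and>
      tridiagonal_pair scale A LinvAs) \<and>
    (td_isomorphic scale A As scale A LAs \<and>
      td_isomorphic scale A As scale A LinvAs \<and>
      td_isomorphic scale A LAs scale A LinvAs) \<and>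
    td_isomorphism scale A LAs scale A As H \<and>
    td_isomorphism scale A As scale A LinvAs H"
proof -
  let ?O = "q_onsager q"
  have V: "alg_module ?O scale \<rho>" and nontrivial: "(UNIV :: 'v set) \<noteq> {0}"
    using V_irreducible by (simp_all add: irreducible_alg_module_def)
  interpret vector_space scale
    by (rule alg_moduleD(1)[OF V])
  have L: "L \<in> alg_hom ?O ?O" "bij_betw L (carrier ?O) (carrier ?O)" "L (onsA q) = onsA q"
    using L_lusztig by (simp_all add: lusztig_automorphism_def alg_automorphism_def)
  note L_carrier = bij_betwE[OF L(2), rule_format]
  let ?M = "inv_into (carrier ?O) L (onsAs q)"
  have M: "?M \<in> carrier ?O" "L ?M = onsAs q"
    using L(2) onsAs_carrier[of q] bij_betw_inv_into_right[OF L(2)]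
    by (auto simp: bij_betw_def intro!: inv_into_into)
  have lin: "Vector_Spaces.linear scale scale A" "Vector_Spaces.linear scale scale As"
    "Vector_Spaces.linear scale scale LAs" "Vector_Spaces.linear scale scale LinvAs"
    using alg_moduleD(2)[OF V] onsA_carrier onsAs_carrier L_carrier M(1)
    by (auto simp: A_def As_def LAs_def LinvAs_def)
  have DG: "dolan_grady scale q A As" "dolan_grady scale q As A"
    unfolding A_def As_def by (rule rep_dolan_grady[OF V])+
  have TD: "tridiagonal_pair scale A As"
  proof (rule tridiagonal_pair_of_dolan_grady[OF q_nonzero q_not_root_of_unity V_finite_dim
        nontrivial lin(1,2) A_diagonalizable As_diagonalizable DG])
    fix U assume U: "subspace U" "A ` U \<subseteq> U" "As ` U \<subseteq> U"
    have "\<rho> x ` U \<subseteq> U" if "x \<in> carrier ?O" for x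
      by (rule invariant_from_generators[OF V U[unfolded A_def As_def] that])
    then show "U = {0} \<or> U = UNIV"
      using V_irreducible U(1) by (simp add: irreducible_alg_module_def)
  qed
  define z where "z i = a * q powi (int d - 2 * int i)" for i
  have z: "z i \<noteq> 0" "z i = q\<^sup>2 * z (Suc i)" for i
  proof -
    show "z i \<noteq> 0"
      using a_nonzero q_nonzero by (simp add: z_def)
    have "int d - 2 * int i = 2 + (int d - 2 * int (Suc i))"
      by simp
    then have "q powi (int d - 2 * int i) = q powi 2 * q powi (int d - 2 * int (Suc i))"
      using q_nonzero by (metis power_int_add)
    then show "z i = q\<^sup>2 * z (Suc i)"
      by (simp add: z_def mult_ac)
  qed
  have \<theta>: "\<theta> i = z i + inverse (z i)" if "i \<le> d" for i
    using \<theta>_formula[OF that] power_int_minus[of q "int d - 2 * int i"] by (simp add: z_def)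
  have H_lin: "Vector_Spaces.linear scale scale H"
    unfolding H_def by (rule linear_H_map[OF lin(1) A_diagonalizable \<theta>_eigenvalues E_projection])
  have "t_pair q \<theta> k (Suc k) \<noteq> 0" if "k < d" for k
    using t_pair_Suc(1)[of q z k \<theta>, OF q_nonzero q_not_root_of_unity z(1) z(1) z(2) \<theta> \<theta>] that
      q_nonzero z(1)[of "Suc k"] by simp
  then have "t_coeff q \<theta> i \<noteq> 0" if "i \<le> d" for i
    using that by (simp add: t_coeff_def)
  then have H_bij: "bij H"
    unfolding H_def by (intro bij_H_map[OF lin(1) A_diagonalizable \<theta>_eigenvalues E_projection])
  have HA: "H \<circ> A = A \<circ> H"
    unfolding H_def by (rule H_map_commutes[OF lin(1) A_diagonalizable \<theta>_eigenvalues E_projection])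
  have LAs_eq: "LAs v = As v + scale (inverse ((q - inverse q) * (q\<^sup>2 - inverse (q\<^sup>2))))
      (op_bracket scale 1 1 A (op_bracket scale q (inverse q) A As) v)" for v
    unfolding LAs_def As_def A_def by (rule rep_lusztig[OF V L_lusztig])
  have HLAs: "H \<circ> LAs = As \<circ> H"
    unfolding H_def
    by (rule H_map_intertwines[OF lin(1) A_diagonalizable \<theta>_eigenvalues E_projection q_nonzero
          q_not_root_of_unity \<theta>_distinct z \<theta> lin(2,3) DG(1) LAs_eq])
  \<comment> \<open>\<open>H\<close> is a homomorphism from the module twisted by \<open>L\<close> to the module itself; it is
    evaluated at the element \<open>?M\<close> that \<open>L\<close> maps to \<open>A\<^sup>*\<close>.\<close>
  have "H \<circ> (\<rho> \<circ> L) ?M = \<rho> ?M \<circ> H"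
  proof (rule intertwiner_from_generators[OF alg_module_precompose[OF V L(1)] V H_lin _ _ M(1)])
    show "H \<circ> (\<rho> \<circ> L) (onsA q) = \<rho> (onsA q) \<circ> H"
      using HA by (simp add: L(3) A_def)
    show "H \<circ> (\<rho> \<circ> L) (onsAs q) = \<rho> (onsAs q) \<circ> H"
      using HLAs by (simp add: LAs_def As_def)
  qed
  then have HAs: "H \<circ> As = LinvAs \<circ> H"
    by (simp add: M(2) As_def LinvAs_def)
  have TDinv: "tridiagonal_pair scale A LinvAs"
    by (rule tridiagonal_pair_transport[OF H_lin H_bij TD lin(1,4) HA HAs])
  have TDL: "tridiagonal_pair scale A LAs"
    by (rule tridiagonal_pair_transport[OF linear_inv[OF H_lin H_bij] bij_betw_inv_into[OF H_bij]
          TD lin(1,3) comp_inv_intertwines[OF H_bij HA] comp_inv_intertwines[OF H_bij HLAs]])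
  have iso1: "td_isomorphism scale A LAs scale A As H"
    using TD TDL H_lin H_bij HA HLAs by (simp add: td_isomorphism_def)
  have iso2: "td_isomorphism scale A As scale A LinvAs H"
    using TD TDinv H_lin H_bij HA HAs by (simp add: td_isomorphism_def)
  show ?thesis
    using TD TDL TDinv iso1 iso2 td_isomorphism_inv[OF iso1] td_isomorphism_comp[OF iso1 iso2]
    unfolding td_isomorphic_def by blast
qed

end
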